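(* Let $h$ be an absolutely monotone function on $[-1,1)$. Then a polynomial $f\in\mathcal P_{17}$ is LP-optimal for $(n,N)=(4,120)$ and $h$ if and only if $f$ is a convex combination of $f_{h,\Lambda_1}$, $f_{h,\Lambda_2}$ and $f_{h,\Lambda_3}$.
   Context: $\mu$ is the probability measure on $[-1,1]$ with density proportional to $(1-t^2)^{1/2}$. $P_i^{(4)}$ is the Gegenbauer polynomial of degree $i$, orthogonal with respect to $\mu$, $P_i^{(4)}(1)=1$. For $f=\sum f_iP_i^{(4)}$, $f_0=\int f\,d\mu$. $\mathcal P_m$ is the space of real polynomials of degree at most $m$. $h$ is absolutely monotone: $h:[-1,1]\to(0,+\infty]$, $h^{(i)}(t)\ge0$ for all $t\in[-1,1)$ and all integers $i\ge0$, and $h(1)=\lim_{t\to1^-}h(t)$. $A_{4,h}$ is the set of continuous $f$ on $[-1,1]$ with $f(t)=\sum_{i\ge0}f_iP_i^{(4)}(t)\le h(t)$ on $[-1,1]$ and $f_i\ge0$ for all $i\ge1$. A polynomial $f\in A_{4,h}$ is LP-optimal for $(n,N)=(4,120)$ and $h$ if it attains the supremum of $120^2\left(p_0-\frac{p(1)}{120}\right)$ over all real polynomials $p\in A_{4,h}$. Let $(\gamma_1,\dots,\gamma_8)=\left(-1,\frac{-1-\sqrt5}4,-\frac12,\frac{1-\sqrt5}4,0,\frac{\sqrt5-1}4,\frac12,\frac{1+\sqrt5}4\right)$ (the inner products between distinct points of the $600$-cell), and $$\Lambda_1=\mathcal P_{10}\oplus\mathrm{span}(P_{13}^{(4)},P_{14}^{(4)},P_{15}^{(4)},P_{16}^{(4)},P_{17}^{(4)}),\quad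 \Lambda_2=\mathcal P_{11}\oplus\mathrm{span}(P_{14}^{(4)},P_{15}^{(4)},P_{16}^{(4)},P_{17}^{(4)}),$$ $$\Lambda_3=\mathcal P_{10}\oplus\mathrm{span}(P_{14}^{(4)},P_{15}^{(4)},P_{16}^{(4)},P_{17}^{(4)}).$$ For $i=1,2$, $f_{h,\Lambda_i}$ is the unique polynomial $f\in\Lambda_i$ with $f(\gamma_j)=h(\gamma_j)$ and $f'(\gamma_j)=h'(\gamma_j)$ for $j=1,\dots,8$ (one-sided derivative of $h$ at $-1$). $f_{h,\Lambda_3}$ is the unique polynomial $f\in\Lambda_3$ with $f(\gamma_j)=h(\gamma_j)$ for $j=1,\dots,8$ and $f'(\gamma_j)=h'(\gamma_j)$ for $j=2,\dots,8$. These polynomials exist, are unique, and belong to $A_{4,h}$. *)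

theory Defs
  imports "HOL-Probability.Probability" "HOL-Computational_Algebra.Polynomial"
begin

text \<open>The normalizing constant is \<open>2 / pi\<close>, see \<open>prob_space_mu4\<close> below.  The
  space of the measure is \<open>[-1,1]\<close>, so the values of a function outside \<open>[-1,1]\<close> do
  not affect its measurability or its integral.\<close>

definition mu4 :: "real measure" where
  "mu4 = density (restrict_space lborel {-1..1}) (\<lambda>t. ennreal (2 / pi * sqrt (1 - t\<^sup>2)))"

lemma prob_space_mu4: "prob_space mu4"
proof
  define F where "F = (\<lambda>t::real. (t * sqrt (1 - t\<^sup>2) + arcsin t) / pi)"
  have der: "(F has_real_derivative 2 / pi * sqrt (1 - t\<^sup>2)) (at t)" if t: "-1 < t" "t < 1" for t
  proof -
    have "t\<^sup>2 < 1" using t by (simp add: abs_square_less_1 abs_if)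
    then have s: "sqrt (1 - t\<^sup>2) > 0" "sqrt (1 - t\<^sup>2) * sqrt (1 - t\<^sup>2) = 1 - t\<^sup>2" by auto
    have "(F has_real_derivative
        (sqrt (1 - t\<^sup>2) + t * (- (2 * t) * (inverse (sqrt (1 - t\<^sup>2)) / 2)) + inverse (sqrt (1 - t\<^sup>2))) / pi) (at t)"
      unfolding F_def using t \<open>t\<^sup>2 < 1\<close>
      by (auto intro!: derivative_eq_intros)
    moreover have "sqrt (1 - t\<^sup>2) + t * (- (2 * t) * (inverse (sqrt (1 - t\<^sup>2)) / 2)) + inverse (sqrt (1 - t\<^sup>2))
        = 2 * sqrt (1 - t\<^sup>2)"
      using s by (simp add: field_simps power2_eq_square)
    ultimately have "(F has_real_derivative 2 * sqrt (1 - t\<^sup>2) / pi) (at t)"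
      by (simp only:)
    then show ?thesis by simp
  qed
  have cont: "continuous_on {-1..1} F"
    unfolding F_def by (intro continuous_intros) auto
  have "((\<lambda>t. 2 / pi * sqrt (1 - t\<^sup>2)) has_integral (F 1 - F (-1))) {-1..1}"
    by (rule fundamental_theorem_of_calculus_interior[OF _ cont])
      (use der in \<open>auto simp: has_real_derivative_iff_has_vector_derivative\<close>)
  moreover have "F 1 - F (-1) = 1"
    by (simp add: F_def field_simps)
  ultimately have I: "((\<lambda>t. 2 / pi * sqrt (1 - t\<^sup>2)) has_integral 1) {-1..1}" by simp
  have nn: "2 / pi * sqrt (1 - t\<^sup>2) \<ge> 0" if "t \<in> {-1..1}" for t :: real
    using that by (auto simp: abs_square_le_1 abs_if)
  have "emeasure mu4 (space mu4) = (\<integral>\<^sup>+t. ennreal (2 / pi * sqrt (1 - t\<^sup>2)) \<partial>restrict_space lborel {-1..1})"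
    unfolding mu4_def
    by (subst emeasure_density)
      (auto intro!: nn_integral_cong measurable_restrict_space1 simp: space_restrict_space sets_restrict_space_iff)
  also have "\<dots> = (\<integral>\<^sup>+t\<in>{-1..1}. ennreal (2 / pi * sqrt (1 - t\<^sup>2)) \<partial>lborel)"
    by (simp add: nn_integral_restrict_space)
  also have "\<dots> = (\<integral>\<^sup>+t. ennreal (indicator {-1..1} t * (2 / pi * sqrt (1 - t\<^sup>2))) \<partial>lborel)"
    by (auto intro!: nn_integral_cong simp: indicator_def)
  also have "\<dots> = ennreal 1"
  proof (rule nn_integral_has_integral_lborel)
    show "(\<lambda>t::real. indicator {-1..1} t * (2 / pi * sqrt (1 - t\<^sup>2))) \<in> borel_measurable borel"
      by measurable
    show "0 \<le> indicator {-1..1} t * (2 / pi * sqrt (1 - t\<^sup>2))" for t :: real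
      using nn[of t] by (auto simp: indicator_def)
    have "((\<lambda>t. if t \<in> {-1..1} then 2 / pi * sqrt (1 - t\<^sup>2) else 0) has_integral 1) UNIV"
      using I by (simp only: has_integral_restrict_UNIV)
    then show "((\<lambda>t. indicator {-1..1} t * (2 / pi * sqrt (1 - t\<^sup>2))) has_integral 1) UNIV"
      by (rule has_integral_eq[rotated]) (simp add: indicator_def)
  qed
  finally show "emeasure mu4 (space mu4) = 1" by simp
qed

definition gegenbauer4 :: "nat \<Rightarrow> real poly" where
  "gegenbauer4 = (THE P. (\<forall>i. degree (P i) = i \<and> poly (P i) 1 = 1) \<and>
     (\<forall>i j. i \<noteq> j \<longrightarrow> (LINT t|mu4. poly (P i) t * poly (P j) t) = 0))"

definition gegenbauer4_coeff :: "(real \<Rightarrow> real) \<Rightarrow> nat \<Rightarrow> real" where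
  "gegenbauer4_coeff f i =
     (LINT t|mu4. f t * poly (gegenbauer4 i) t) / (LINT t|mu4. (poly (gegenbauer4 i) t)\<^sup>2)"

text \<open>\<open>D i\<close> is the \<open>i\<close>-th derivative of \<open>h\<close> on \<open>[-1,1)\<close>, one-sided at \<open>-1\<close>;
  \<open>h\<close> is finite on \<open>[-1,1)\<close>, and \<open>h 1\<close> may be infinite.\<close>

definition absolutely_monotone :: "(real \<Rightarrow> ereal) \<Rightarrow> bool" where
  "absolutely_monotone h \<longleftrightarrow>
     (\<forall>t\<in>{-1..1}. 0 < h t) \<and>
     (\<exists>D :: nat \<Rightarrow> real \<Rightarrow> real.
        (\<forall>t\<in>{-1..<1}. h t = ereal (D 0 t)) \<and>
        (\<forall>i. \<forall>t\<in>{-1..<1}. (D i has_real_derivative D (Suc i) t) (at t within {-1..<1})) \<and>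
        (\<forall>i. \<forall>t\<in>{-1..<1}. 0 \<le> D i t)) \<and>
     (h \<longlongrightarrow> h 1) (at_left 1)"

definition A4 :: "(real \<Rightarrow> ereal) \<Rightarrow> (real \<Rightarrow> real) set" where
  "A4 h = {f. continuous_on {-1..1} f \<and>
     (\<forall>t\<in>{-1..1}. (\<lambda>i. gegenbauer4_coeff f i * poly (gegenbauer4 i) t) sums f t) \<and>
     (\<forall>t\<in>{-1..1}. ereal (f t) \<le> h t) \<and>
     (\<forall>i\<ge>1. 0 \<le> gegenbauer4_coeff f i)}"

text \<open>The integral in \<open>LP_value\<close> is the coefficient \<open>p\<^sub>0\<close>.\<close>

definition LP_value :: "nat \<Rightarrow> real poly \<Rightarrow> real" where
  "LP_value N p = (real N)\<^sup>2 * ((LINT t|mu4. poly p t) - poly p 1 / real N)"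

definition LP_optimal :: "nat \<Rightarrow> (real \<Rightarrow> ereal) \<Rightarrow> real poly \<Rightarrow> bool" where
  "LP_optimal N h f \<longleftrightarrow> poly f \<in> A4 h \<and>
     ereal (LP_value N f) = (SUP p\<in>{p. poly p \<in> A4 h}. ereal (LP_value N p))"

definition gamma600 :: "nat \<Rightarrow> real" where
  "gamma600 j = [-1, (-1 - sqrt 5) / 4, -1/2, (1 - sqrt 5) / 4, 0,
                 (sqrt 5 - 1) / 4, 1/2, (1 + sqrt 5) / 4] ! (j - 1)"

definition poly_space :: "nat \<Rightarrow> nat set \<Rightarrow> real poly set" where
  "poly_space m I =
     {p + (\<Sum>i\<in>I. smult (c i) (gegenbauer4 i)) | p c. degree p \<le> m}"

definition Lambda1 :: "real poly set" where "Lambda1 = poly_space 10 {13..17}"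
definition Lambda2 :: "real poly set" where "Lambda2 = poly_space 11 {14..17}"
definition Lambda3 :: "real poly set" where "Lambda3 = poly_space 10 {14..17}"

text \<open>Values of \<open>h\<close> are matched at all eight nodes, derivatives at the nodes with
  index in \<open>J\<close>; the derivative of \<open>h\<close> at \<open>-1\<close> is one-sided.\<close>

definition interpolates :: "nat set \<Rightarrow> (real \<Rightarrow> ereal) \<Rightarrow> real poly \<Rightarrow> bool" where
  "interpolates J h f \<longleftrightarrow>
     (\<forall>j\<in>{1..8}. ereal (poly f (gamma600 j)) = h (gamma600 j)) \<and>
     (\<forall>j\<in>J. ((\<lambda>t. real_of_ereal (h t)) has_real_derivative poly (pderiv f) (gamma600 j))
        (at (gamma600 j) within {-1..<1}))"

definition f_Lambda1 :: "(real \<Rightarrow> ereal) \<Rightarrow> real poly" where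
  "f_Lambda1 h = (THE f. f \<in> Lambda1 \<and> interpolates {1..8} h f)"

definition f_Lambda2 :: "(real \<Rightarrow> ereal) \<Rightarrow> real poly" where
  "f_Lambda2 h = (THE f. f \<in> Lambda2 \<and> interpolates {1..8} h f)"

definition f_Lambda3 :: "(real \<Rightarrow> ereal) \<Rightarrow> real poly" where
  "f_Lambda3 h = (THE f. f \<in> Lambda3 \<and> interpolates {2..8} h f)"

end

theory Submission
  imports Defs
begin

text \<open>Write \<open>U\<^sub>i\<close> for the Chebyshev polynomials of the second kind, so that
  \<open>P\<^sub>i = U\<^sub>i / (i + 1)\<close>. The sum of \<open>U\<^sub>i\<close> over the 600-cell is nonnegative for every \<open>i\<close>, vanishes for
  \<open>1 \<le> i \<le> 17\<close>, \<open>i \<noteq> 12\<close>, and is positive for \<open>i = 12\<close>. Hence the linear program is bounded by the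
  energy of the 600-cell, and a feasible \<open>f\<close> of degree at most 17 attains the bound iff it agrees
  with \<open>h\<close> at the nodes and \<open>f\<^sub>1\<^sub>2 = 0\<close>. Feasibility forces \<open>f' = h'\<close> at the interior nodes and
  \<open>f' \<le> h'\<close> at \<open>-1\<close>, so \<open>f = H + W q\<close> with \<open>H\<close> the Hermite interpolant at the doubled nodes,
  \<open>W = (2t + 2) \<Prod>\<^sub>j\<^sub>\<ge>\<^sub>2 (2t - 2\<gamma>\<^sub>j)\<^sup>2\<close> and \<open>q\<close> quadratic. On the plane \<open>f\<^sub>1\<^sub>2 = 0\<close> the three nonnegative
  quantities \<open>f\<^sub>1\<^sub>1\<close>, \<open>f\<^sub>1\<^sub>3\<close> and \<open>-q(-1)\<close> satisfy a linear relation with positive coefficients, so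
  they cut out a triangle; its corners are the three interpolants.

  The corners are feasible because \<open>h\<close> has a Newton expansion at the doubled nodes with
  nonnegative coefficients and nonnegative remainder. As the corners depend linearly on \<open>h\<close>, this
  leaves sixteen Newton polynomials to be checked, with coefficients in \<open>\<int>[\<phi>]\<close>, \<open>\<phi>\<close> the golden ratio.\<close>

section \<open>Chebyshev polynomials of the second kind\<close>

fun cheb_U :: "nat \<Rightarrow> real poly" where
  "cheb_U 0 = 1"
| "cheb_U (Suc 0) = [:0, 2:]"
| "cheb_U (Suc (Suc n)) = [:0, 2:] * cheb_U (Suc n) - cheb_U n"

lemma degree_cheb_U: "degree (cheb_U n) = n"
  and lead_coeff_cheb_U: "lead_coeff (cheb_U n) = 2 ^ n"
proof -
  have "degree (cheb_U n) = n \<and> coeff (cheb_U n) n = 2 ^ n"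
  proof (induction n rule: cheb_U.induct)
    case (3 n)
    have d: "degree ([:0, 2:] * cheb_U (Suc n)) = Suc (Suc n)"
      using 3 by (subst degree_mult_eq) auto
    have "degree (cheb_U (Suc (Suc n))) = Suc (Suc n)"
      using 3 d by (simp only: cheb_U.simps diff_conv_add_uminus)
        (subst degree_add_eq_left; simp)
    moreover have "coeff (cheb_U n) (Suc (Suc n)) = 0"
      using 3 by (intro coeff_eq_0) simp
    ultimately show ?case
      using 3 by (simp add: mult_pCons_left coeff_pCons)
  qed auto
  then show "degree (cheb_U n) = n" "lead_coeff (cheb_U n) = 2 ^ n" by auto
qed

lemma poly_cheb_U_1: "poly (cheb_U n) 1 = real n + 1"
  by (induction n rule: cheb_U.induct) (auto simp: algebra_simps)

lemma sin_mult_cheb_U: "sin x * poly (cheb_U n) (cos x) = sin ((real n + 1) * x)"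
proof (induction n rule: cheb_U.induct)
  case (2)
  have "sin (2 * x) = 2 * sin x * cos x" by (rule sin_double)
  then show ?case by (simp add: mult.assoc)
next
  case (3 n)
  have "sin ((real n + 3) * x) + sin ((real n + 1) * x) = 2 * cos x * sin ((real n + 2) * x)"
    using sin_plus_sin[of "(real n + 3) * x" "(real n + 1) * x"]
    by (simp add: algebra_simps add_divide_distrib diff_divide_distrib)
  then show ?case using 3 by (simp add: algebra_simps)
qed auto

text \<open>The second form turns the integral over \<open>mu4\<close> into a gauge integral, to
  which the fundamental theorem of calculus applies.\<close>

lemma integrable_poly_mu4 [simp]: "integrable mu4 (poly p)"
  and LINT_poly_mu4: "((\<lambda>t. 2 / pi * sqrt (1 - t\<^sup>2) * poly p t) has_integral (LINT t|mu4. poly p t)) {-1..1}"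
proof -
  have meas: "(\<lambda>t. 2 / pi * sqrt (1 - t\<^sup>2)) \<in> borel_measurable (restrict_space lborel {-1..1})"
    "poly p \<in> borel_measurable (restrict_space lborel {-1..1})"
    by (auto intro!: measurable_restrict_space1 borel_measurable_continuous_onI continuous_intros)
  have nn: "AE t in restrict_space lborel {-1..1}. 0 \<le> 2 / pi * sqrt (1 - t\<^sup>2)"
    by (auto intro!: AE_I2 simp: space_restrict_space abs_square_le_1 abs_if)
  have s: "set_integrable lborel {-1..1} (\<lambda>t. 2 / pi * sqrt (1 - t\<^sup>2) * poly p t)"
    by (intro borel_integrable_atLeastAtMost') (auto intro!: continuous_intros)
  show "integrable mu4 (poly p)"
    unfolding mu4_def using s
    by (subst integrable_density[OF meas(2,1) nn])
      (simp add: integrable_restrict_space set_integrable_def)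
  have "(LINT t|mu4. poly p t) = (LINT t:{-1..1}|lborel. 2 / pi * sqrt (1 - t\<^sup>2) * poly p t)"
    unfolding mu4_def
    by (subst integral_density[OF meas(2,1) nn]) (simp add: integral_restrict_space set_lebesgue_integral_def)
  then show "((\<lambda>t. 2 / pi * sqrt (1 - t\<^sup>2) * poly p t) has_integral (LINT t|mu4. poly p t)) {-1..1}"
    using set_borel_integral_eq_integral[OF s] by (simp add: has_integral_iff)
qed

text \<open>With \<open>t = cos x\<close>, the function \<open>cheb_U n t * sqrt (1 - t\<^sup>2)\<close> is
  \<open>sin ((n + 1) x)\<close>, half the derivative of
  \<open>sin ((n + 2) x) / (n + 2) - sin (n x) / n\<close> with respect to \<open>t\<close>.\<close>
lemma LINT_cheb_U: "(LINT t|mu4. poly (cheb_U n) t) = (if n = 0 then 1 else 0)"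
proof (cases "n = 0")
  case True
  then show ?thesis using prob_space.prob_space[OF prob_space_mu4] by simp
next
  case False
  define a b where "a = real n" and "b = real n + 2"
  have ab: "a > 0" "b > 0" using False by (auto simp: a_def b_def)
  define G where "G = (\<lambda>t. (sin (b * arccos t) / b - sin (a * arccos t) / a) / pi)"
  have "(G has_real_derivative 2 / pi * sqrt (1 - t\<^sup>2) * poly (cheb_U n) t) (at t)" if t: "t \<in> {-1<..<1}" for t
  proof -
    define x where "x = arccos t"
    have ct: "t = cos x" using t by (simp add: x_def)
    have s: "sqrt (1 - t\<^sup>2) = sin x" using t by (simp add: x_def sin_arccos)
    have sp: "sin x > 0" using t by (simp add: s[symmetric] abs_square_less_1 abs_if)
    have G: "(G has_real_derivative (cos (a * x) - cos (b * x)) / sin x / pi) (at t)"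
      unfolding G_def using t ab sp
      by (auto intro!: derivative_eq_intros simp: x_def[symmetric] s field_simps)
    have c: "cos (a * x) - cos (b * x) = 2 * sin x * sin ((real n + 1) * x)"
      using cos_diff_cos[of "a * x" "b * x"]
      by (simp add: a_def b_def algebra_simps add_divide_distrib diff_divide_distrib)
    have P: "sin x * poly (cheb_U n) t = sin ((real n + 1) * x)"
      using sin_mult_cheb_U[of x n] ct by simp
    have "(cos (a * x) - cos (b * x)) / sin x / pi = 2 / pi * sqrt (1 - t\<^sup>2) * poly (cheb_U n) t"
      using sp by (simp add: s c flip: P)
    then show ?thesis using G by (simp only:)
  qed
  moreover have "continuous_on {-1..1} G"
    unfolding G_def using ab by (intro continuous_intros) auto
  ultimately have I: "((\<lambda>t. 2 / pi * sqrt (1 - t\<^sup>2) * poly (cheb_U n) t) has_integral (G 1 - G (-1))) {-1..1}"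
    by (intro fundamental_theorem_of_calculus_interior)
      (auto simp: has_real_derivative_iff_has_vector_derivative)
  moreover have "G 1 - G (-1) = 0"
    using sin_npi[of n] sin_npi[of "n + 2"] by (simp add: G_def a_def b_def add.commute)
  ultimately show ?thesis
    using has_integral_unique[OF LINT_poly_mu4 I] False by simp
qed

text \<open>As the \<open>cheb_U i\<close> are orthonormal for \<open>mu4\<close>, this is the
  coefficient of \<open>cheb_U i\<close> in \<open>p\<close>; for polynomials
  \<open>gegenbauer4_coeff\<close> differs from it by the positive factor i + 1.\<close>

definition ucoef :: "real poly \<Rightarrow> nat \<Rightarrow> real" where
  "ucoef p i = (LINT t|mu4. poly p t * poly (cheb_U i) t)"

lemma integrable_poly_mult_mu4 [simp]: "integrable mu4 (\<lambda>t. poly p t * poly q t)"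
  using integrable_poly_mu4[of "p * q"] by (simp add: poly_mult[abs_def])

lemma ucoef_add [simp]: "ucoef (p + q) i = ucoef p i + ucoef q i"
  by (simp add: ucoef_def distrib_right)

lemma ucoef_smult [simp]: "ucoef (smult c p) i = c * ucoef p i"
  by (simp add: ucoef_def mult.assoc)

lemma ucoef_diff [simp]: "ucoef (p - q) i = ucoef p i - ucoef q i"
  using ucoef_add[of p "smult (-1) q" i] ucoef_smult[of "-1" q i] by simp

lemma ucoef_0 [simp]: "ucoef 0 i = 0"
  by (simp add: ucoef_def)

lemma ucoef_sum: "ucoef (\<Sum>k\<in>A. p k) i = (\<Sum>k\<in>A. ucoef (p k) i)"
  by (induction A rule: infinite_finite_induct) auto

lemma ucoef_X_0: "ucoef ([:0, 2:] * p) 0 = ucoef p (Suc 0)"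
  by (simp add: ucoef_def mult_ac)

text \<open>Multiplication by 2t is self-adjoint, so the three-term recurrence can be applied to the
  factor \<open>cheb_U\<close>.\<close>

lemma ucoef_X_Suc: "ucoef ([:0, 2:] * p) (Suc i) = ucoef p i + ucoef p (Suc (Suc i))"
proof -
  have "poly ([:0, 2:] * p) t * poly (cheb_U (Suc i)) t =
      poly p t * poly (cheb_U i) t + poly p t * poly (cheb_U (Suc (Suc i))) t" for t
    by (simp add: algebra_simps)
  then have "ucoef ([:0, 2:] * p) (Suc i) =
      (LINT t|mu4. poly p t * poly (cheb_U i) t + poly p t * poly (cheb_U (Suc (Suc i))) t)"
    unfolding ucoef_def by presburger
  then show ?thesis
    unfolding ucoef_def by (simp del: cheb_U.simps)
qed

text \<open>Induction along the recurrence in \<open>m\<close>; only the integrals against the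
  constant 1, from \<open>LINT_cheb_U\<close>, enter.\<close>

lemma ucoef_cheb_U: "ucoef (cheb_U m) i = (if m = i then 1 else 0)"
proof -
  have "\<forall>i. ucoef (cheb_U m) i = (if m = i then 1 else 0)"
  proof (induction m rule: cheb_U.induct)
    case 1
    then show ?case by (auto simp: ucoef_def LINT_cheb_U)
  next
    case 2
    have "ucoef [:0, 2:] i = (if Suc 0 = i then 1 else 0)" for i
      using ucoef_X_0[of 1] ucoef_X_Suc[of 1]
      by (cases i) (auto simp: ucoef_def LINT_cheb_U simp del: cheb_U.simps(2,3))
    then show ?case by simp
  next
    case (3 m)
    show ?case
    proof
      fix i
      show "ucoef (cheb_U (Suc (Suc m))) i = (if Suc (Suc m) = i then 1 else 0)"
        using 3 ucoef_X_0[of "cheb_U (Suc m)"] ucoef_X_Suc[of "cheb_U (Suc m)"]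
        by (cases i) (simp_all only: cheb_U.simps(3) ucoef_diff, auto)
    qed
  qed
  then show ?thesis by blast
qed

text \<open>Removing leading terms one by one gives some expansion, since \<open>cheb_U n\<close>
  has degree n; orthonormality identifies its coefficients.\<close>

lemma ucoef_eq_0: "degree p < i \<Longrightarrow> ucoef p i = 0"
  and cheb_U_expansion: "degree p \<le> n \<Longrightarrow> p = (\<Sum>i\<le>n. smult (ucoef p i) (cheb_U i))"
proof -
  have *: "\<exists>c. p = (\<Sum>i\<le>n. smult (c i) (cheb_U i))" if "degree p \<le> n" for n :: nat and p
    using that
  proof (induction n arbitrary: p)
    case 0
    then show ?case by (auto elim!: degree_eq_zeroE intro!: exI[of _ "\<lambda>_. coeff p 0"])
  next
    case (Suc n)
    define c where "c = coeff p (Suc n) / 2 ^ Suc n"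
    define q where "q = p - smult c (cheb_U (Suc n))"
    have "degree q \<le> Suc n"
      unfolding q_def using Suc.prems
      by (intro degree_diff_le) (auto simp: degree_cheb_U)
    moreover have "coeff q (Suc n) = 0"
      using lead_coeff_cheb_U[of "Suc n"] by (simp add: q_def c_def degree_cheb_U del: cheb_U.simps)
    ultimately have "degree q \<le> n"
      by (metis le_SucE leading_coeff_0_iff degree_0 zero_le)
    then obtain d where d: "q = (\<Sum>i\<le>n. smult (d i) (cheb_U i))" using Suc.IH by blast
    have "p = (\<Sum>i\<le>Suc n. smult ((d(Suc n := c)) i) (cheb_U i))"
      using d by (simp add: q_def eq_diff_eq)
    then show ?case by blast
  qed
  have coef: "ucoef (\<Sum>i\<le>n. smult (c i) (cheb_U i)) j = (if j \<le> n then c j else 0)" for c n j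
    by (simp add: ucoef_sum ucoef_cheb_U if_distrib cong: if_cong)
  show "ucoef p i = 0" if "degree p < i"
    using *[OF order_refl, of p] coef that by (metis not_le)
  show "p = (\<Sum>i\<le>n. smult (ucoef p i) (cheb_U i))" if pn: "degree p \<le> n"
  proof -
    obtain c where c: "p = (\<Sum>i\<le>n. smult (c i) (cheb_U i))" using *[OF pn] by blast
    then have "ucoef p i = c i" if "i \<le> n" for i using coef that by simp
    then show ?thesis by (subst c) (auto intro!: sum.cong)
  qed
qed

lemma degree_le_iff_ucoef: "degree p \<le> n \<longleftrightarrow> (\<forall>i>n. ucoef p i = 0)"
proof
  assume r: "\<forall>i>n. ucoef p i = 0"
  define m where "m = max n (degree p)"
  have "p = (\<Sum>i\<le>m. smult (ucoef p i) (cheb_U i))"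
    by (rule cheb_U_expansion) (simp add: m_def)
  also have "degree \<dots> \<le> n"
  proof (intro degree_sum_le)
    show "degree (smult (ucoef p i) (cheb_U i)) \<le> n" if "i \<in> {..m}" for i
      using r degree_cheb_U[of i] by (cases "i \<le> n") auto
  qed auto
  finally show "degree p \<le> n" .
qed (auto intro: ucoef_eq_0)

text \<open>Uniqueness for the \<open>THE\<close>: by strong induction P i is orthogonal to all
  lower \<open>cheb_U j\<close>, hence a multiple of \<open>cheb_U i\<close>, and U_i(1) = i + 1
  fixes the scalar.\<close>

lemma gegenbauer4_eq: "gegenbauer4 i = smult (1 / (real i + 1)) (cheb_U i)"
proof -
  let ?P = "\<lambda>i. smult (1 / (real i + 1)) (cheb_U i)"
  have "gegenbauer4 = ?P"
    unfolding gegenbauer4_def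
  proof (rule the_equality)
    show "(\<forall>i. degree (?P i) = i \<and> poly (?P i) 1 = 1) \<and>
      (\<forall>i j. i \<noteq> j \<longrightarrow> (LINT t|mu4. poly (?P i) t * poly (?P j) t) = 0)"
    proof (intro conjI allI impI)
      fix i j :: nat assume "i \<noteq> j"
      have "(LINT t|mu4. poly (?P i) t * poly (?P j) t) = ucoef (smult (1 / (real i + 1) * (1 / (real j + 1))) (cheb_U i)) j"
        unfolding ucoef_def by (simp add: mult_ac)
      then show "(LINT t|mu4. poly (?P i) t * poly (?P j) t) = 0"
        using \<open>i \<noteq> j\<close> by (simp add: ucoef_cheb_U)
    qed (auto simp: degree_cheb_U poly_cheb_U_1 add_nonneg_eq_0_iff)
  next
    fix P assume P: "(\<forall>i. degree (P i) = i \<and> poly (P i) 1 = 1) \<and>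
      (\<forall>i j. i \<noteq> j \<longrightarrow> (LINT t|mu4. poly (P i) t * poly (P j) t) = 0)"
    have "P i = ?P i" for i
    proof (induction i rule: less_induct)
      case (less i)
      have z: "ucoef (P i) j = 0" if j: "j < i" for j
      proof -
        have "(LINT t|mu4. poly (P i) t * poly (?P j) t) = 0"
          using P less.IH[OF j] j by (metis less_irrefl)
        moreover have "(LINT t|mu4. poly (P i) t * poly (?P j) t) = ucoef (smult (1 / (real j + 1)) (P i)) j"
          unfolding ucoef_def by (simp add: mult_ac)
        ultimately show ?thesis by (simp add: add_nonneg_eq_0_iff)
      qed
      have "P i = (\<Sum>j\<le>i. smult (ucoef (P i) j) (cheb_U j))"
        using P by (intro cheb_U_expansion) simp
      also have "\<dots> = (\<Sum>j\<in>{i}. smult (ucoef (P i) j) (cheb_U j))"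
        using z by (intro sum.mono_neutral_right) auto
      finally have e: "P i = smult (ucoef (P i) i) (cheb_U i)" by simp
      have "poly (P i) 1 = 1" using P by blast
      then have "ucoef (P i) i * (real i + 1) = 1"
        by (subst (asm) e) (simp add: poly_cheb_U_1)
      then have "ucoef (P i) i = 1 / (real i + 1)" by (simp add: field_simps)
      then show ?case using e by simp
    qed
    then show "P = ?P" by auto
  qed
  then show ?thesis by (rule fun_cong)
qed

lemma gegenbauer4_coeff_poly: "gegenbauer4_coeff (poly p) i = (real i + 1) * ucoef p i"
proof -
  have "(LINT t|mu4. poly p t * poly (gegenbauer4 i) t) = ucoef (smult (1 / (real i + 1)) p) i"
    unfolding ucoef_def by (simp add: gegenbauer4_eq mult_ac)
  moreover have "(LINT t|mu4. (poly (gegenbauer4 i) t)\<^sup>2) = ucoef (smult ((1 / (real i + 1))\<^sup>2) (cheb_U i)) i"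
    unfolding ucoef_def by (simp add: gegenbauer4_eq power2_eq_square mult_ac)
  ultimately show ?thesis
    by (simp add: gegenbauer4_coeff_def ucoef_cheb_U power2_eq_square)
qed

lemma poly_in_A4_iff:
  "poly p \<in> A4 h \<longleftrightarrow> (\<forall>t\<in>{-1..1}. ereal (poly p t) \<le> h t) \<and> (\<forall>i\<ge>1. 0 \<le> ucoef p i)"
proof -
  have "(\<lambda>i. gegenbauer4_coeff (poly p) i * poly (gegenbauer4 i) t) sums poly p t" for t
  proof -
    have "gegenbauer4_coeff (poly p) i * poly (gegenbauer4 i) t = ucoef p i * poly (cheb_U i) t" for i
      by (simp add: gegenbauer4_coeff_poly gegenbauer4_eq add_nonneg_eq_0_iff)
    moreover have "(\<lambda>i. ucoef p i * poly (cheb_U i) t) sums (\<Sum>i\<le>degree p. ucoef p i * poly (cheb_U i) t)"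
      by (rule sums_finite) (auto intro: ucoef_eq_0)
    moreover have "(\<Sum>i\<le>degree p. ucoef p i * poly (cheb_U i) t) = poly p t"
      by (subst (4) cheb_U_expansion[OF order_refl]) (simp add: poly_sum)
    ultimately show ?thesis by simp
  qed
  moreover have "continuous_on {-1..1} (poly p)"
    by (intro continuous_intros)
  moreover have "0 \<le> gegenbauer4_coeff (poly p) i \<longleftrightarrow> 0 \<le> ucoef p i" for i
    by (simp add: gegenbauer4_coeff_poly zero_le_mult_iff)
  ultimately show ?thesis
    unfolding A4_def by simp
qed

text \<open>Membership in \<open>Lambda1\<close>, \<open>Lambda2\<close>, \<open>Lambda3\<close>
  thus becomes the vanishing of coefficients in a gap of degrees.\<close>

lemma poly_space_iff:
  assumes "m < l" "l \<le> n"
  shows "f \<in> poly_space m {l..n} \<longleftrightarrow> degree f \<le> n \<and> (\<forall>i. m < i \<and> i < l \<longrightarrow> ucoef f i = 0)"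
proof
  assume "f \<in> poly_space m {l..n}"
  then obtain p c where f: "f = p + (\<Sum>i\<in>{l..n}. smult (c i) (gegenbauer4 i))" and p: "degree p \<le> m"
    by (auto simp: poly_space_def)
  have u: "ucoef f i = 0" if "m < i" "i \<notin> {l..n}" for i
    using that p by (auto simp: f ucoef_sum gegenbauer4_eq ucoef_cheb_U ucoef_eq_0 intro!: sum.neutral)
  then show "degree f \<le> n \<and> (\<forall>i. m < i \<and> i < l \<longrightarrow> ucoef f i = 0)"
    using assms by (auto simp: degree_le_iff_ucoef)
next
  assume f: "degree f \<le> n \<and> (\<forall>i. m < i \<and> i < l \<longrightarrow> ucoef f i = 0)"
  define p where "p = (\<Sum>i\<le>m. smult (ucoef f i) (cheb_U i))"
  define c where "c = (\<lambda>i. (real i + 1) * ucoef f i)"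
  have s: "smult (c i) (gegenbauer4 i) = smult (ucoef f i) (cheb_U i)" for i
    by (simp add: c_def gegenbauer4_eq add_nonneg_eq_0_iff)
  have "f = (\<Sum>i\<le>n. smult (ucoef f i) (cheb_U i))"
    using f by (intro cheb_U_expansion) simp
  also have "\<dots> = (\<Sum>i\<in>{..m} \<union> {l..n}. smult (ucoef f i) (cheb_U i))"
    using f assms by (intro sum.mono_neutral_right) (auto simp: not_le)
  also have "\<dots> = p + (\<Sum>i\<in>{l..n}. smult (c i) (gegenbauer4 i))"
    using assms unfolding p_def s by (subst sum.union_disjoint) auto
  finally have "f = p + (\<Sum>i\<in>{l..n}. smult (c i) (gegenbauer4 i))" .
  moreover have "degree p \<le> m"
    unfolding p_def
  proof (intro degree_sum_le)
    show "degree (smult (ucoef f i) (cheb_U i)) \<le> m" if "i \<in> {..m}" for i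
      using that degree_cheb_U[of i] by auto
  qed auto
  ultimately show "f \<in> poly_space m {l..n}" by (auto simp: poly_space_def)
qed

section \<open>Divided differences of absolutely monotone functions\<close>

text \<open>Nonnegativity replaces positivity and the point 1 is left out: this class is closed
  under divided differences, which may vanish.\<close>

definition real_am :: "(real \<Rightarrow> real) \<Rightarrow> bool" where
  "real_am g \<longleftrightarrow> (\<exists>D :: nat \<Rightarrow> real \<Rightarrow> real.
     (\<forall>t\<in>{-1..<1}. g t = D 0 t) \<and>
     (\<forall>i. \<forall>t\<in>{-1..<1}. (D i has_real_derivative D (Suc i) t) (at t within {-1..<1})) \<and>
     (\<forall>i. \<forall>t\<in>{-1..<1}. 0 \<le> D i t))"

lemma real_am_nonneg: "real_am g \<Longrightarrow> t \<in> {-1..<1} \<Longrightarrow> 0 \<le> g t"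
  unfolding real_am_def by metis

lemma real_am_differentiable:
  assumes "real_am g" "t \<in> {-1..<1}"
  obtains g' where "(g has_real_derivative g') (at t within {-1..<1})"
proof -
  obtain D where D: "\<forall>t\<in>{-1..<1}. g t = D 0 t"
    "\<forall>i. \<forall>t\<in>{-1..<1}. (D i has_real_derivative D (Suc i) t) (at t within {-1..<1})"
    using assms(1) unfolding real_am_def by blast
  have "(g has_real_derivative D 1 t) (at t within {-1..<1})"
    using D assms(2)
    by (intro has_field_derivative_transform_within[of "D 0" "D 1 t" t "{-1..<1}" 1 g]) auto
  then show thesis by (rule that)
qed

text \<open>The divided difference \<open>g[a, t] = \<integral>\<^sub>0\<^sup>1 g'(a + s (t - a)) ds\<close> of an
  absolutely monotone function is again absolutely monotone in \<open>t\<close>, by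
  differentiating under the integral sign. The factor 2 comes from the variable \<open>2t\<close>.\<close>
lemma real_am_divided_difference:
  assumes "real_am g" and a: "a \<in> {-1..<1}"
  obtains r where "real_am r" and "\<And>t. t \<in> {-1..<1} \<Longrightarrow> g t = g a + (2 * t - 2 * a) * r t"
proof -
  obtain D where D0: "\<And>t. t \<in> {-1..<1} \<Longrightarrow> g t = D 0 t"
    and DD: "\<And>i t. t \<in> {-1..<1} \<Longrightarrow> (D i has_real_derivative D (Suc i) t) (at t within {-1..<1})"
    and Dn: "\<And>i t. t \<in> {-1..<1} \<Longrightarrow> 0 \<le> D i t"
    using assms(1) unfolding real_am_def by metis
  have seg: "a + s * (t - a) \<in> {-1..<1}" if "t \<in> {-1..<1}" "s \<in> {0..1}" for s t :: real
  proof -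
    have "(1 - s) *\<^sub>R a + s *\<^sub>R t \<in> {-1..<1::real}"
      using that a by (intro convexD) (auto simp: convex_real_interval)
    then show ?thesis by (simp add: algebra_simps)
  qed
  have Dc: "continuous_on {-1..<1} (D i)" for i
    using DD by (meson DERIV_continuous continuous_on_eq_continuous_within)
  \<comment> \<open>\<open>I i s t\<close> is the i-th derivative in \<open>t\<close> of D 1 (a + s
    (t - a)); each differentiation brings out a factor \<open>s\<close>.\<close>
  define I where "I = (\<lambda>i s t. s ^ i * D (Suc i) (a + s * (t - a)))"
  define E where "E = (\<lambda>i t. integral (cbox 0 1) (\<lambda>s. I i s t) / 2)"
  have Ic: "continuous_on ({-1..<1} \<times> cbox 0 1) (\<lambda>(t, s). I i s t)" for i
    unfolding I_def case_prod_beta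
    by (intro continuous_intros continuous_on_compose2[OF Dc]) (use seg in auto)
  have Ic1: "continuous_on (cbox 0 1) (\<lambda>s. I i s t)" if "t \<in> {-1..<1}" for i t
    unfolding I_def
    by (intro continuous_intros continuous_on_compose2[OF Dc]) (use seg that in auto)
  have Id: "((\<lambda>t. I i s t) has_real_derivative I (Suc i) s t) (at t within {-1..<1})"
    if "t \<in> {-1..<1}" "s \<in> cbox 0 1" for i s t
  proof -
    have "(D (Suc i) has_real_derivative D (Suc (Suc i)) (a + s * (t - a)))
        (at (a + s * (t - a)) within (\<lambda>t. a + s * (t - a)) ` {-1..<1})"
      using that seg by (intro DERIV_subset[OF DD]) auto
    moreover have "((\<lambda>t. a + s * (t - a)) has_real_derivative s) (at t within {-1..<1})"
      by (auto intro!: derivative_eq_intros)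
    ultimately have "((\<lambda>t. D (Suc i) (a + s * (t - a))) has_real_derivative D (Suc (Suc i)) (a + s * (t - a)) * s)
        (at t within {-1..<1})"
      using DERIV_image_chain by (fastforce simp: o_def)
    from DERIV_cmult[OF this, of "s ^ i"] show ?thesis
      by (simp add: I_def mult_ac)
  qed
  have "real_am (E 0)"
    unfolding real_am_def
  proof (intro exI[of _ E] conjI allI ballI)
    fix i and t :: real assume t: "t \<in> {-1..<1}"
    have "((\<lambda>t. integral (cbox 0 1) (\<lambda>s. I i s t)) has_real_derivative
        integral (cbox 0 1) (\<lambda>s. I (Suc i) s t)) (at t within {-1..<1})"
      using t Id Ic Ic1
      by (intro leibniz_rule_field_derivative integrable_continuous) (auto simp: convex_real_interval)
    then show "(E i has_real_derivative E (Suc i) t) (at t within {-1..<1})"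
      unfolding E_def by (rule DERIV_cdivide)
    show "0 \<le> E i t"
      unfolding E_def using Dn seg t
      by (intro divide_nonneg_pos Henstock_Kurzweil_Integration.integral_nonneg
          integrable_continuous Ic1) (auto simp: I_def)
  qed auto
  moreover have "g t = g a + (2 * t - 2 * a) * E 0 t" if t: "t \<in> {-1..<1}" for t
  proof -
    have "((\<lambda>s. (t - a) * I 0 s t) has_integral D 0 (a + 1 * (t - a)) - D 0 (a + 0 * (t - a))) {0..1}"
    proof (rule fundamental_theorem_of_calculus)
      fix s :: real assume s: "s \<in> {0..1}"
      have "(D 0 has_real_derivative D (Suc 0) (a + s * (t - a)))
          (at (a + s * (t - a)) within (\<lambda>s. a + s * (t - a)) ` {0..1})"
        by (intro DERIV_subset[OF DD]) (use seg t s in auto)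
      moreover have "((\<lambda>s. a + s * (t - a)) has_real_derivative t - a) (at s within {0..1})"
        by (auto intro!: derivative_eq_intros)
      ultimately have "((\<lambda>s. D 0 (a + s * (t - a))) has_real_derivative D (Suc 0) (a + s * (t - a)) * (t - a)) (at s within {0..1})"
        using DERIV_image_chain by (fastforce simp: o_def)
      then show "((\<lambda>s. D 0 (a + s * (t - a))) has_vector_derivative (t - a) * I 0 s t) (at s within {0..1})"
        by (simp add: has_real_derivative_iff_has_vector_derivative I_def mult_ac)
    qed auto
    from integral_unique[OF this] have "(t - a) * integral {0..1} (\<lambda>s. I 0 s t) = D 0 t - D 0 a"
      unfolding Henstock_Kurzweil_Integration.integral_mult_right by simp
    then show ?thesis using D0 t a by (simp add: E_def field_simps)
  qed
  ultimately show thesis by (rule that)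
qed

text \<open>The factors are 2t - 2a because the numbers 2a lie in Z[phi] for the nodes of the
  600-cell, and multiplication by 2t is integral in the basis \<open>cheb_U\<close>.\<close>

definition node_poly :: "real list \<Rightarrow> real poly" where
  "node_poly ts = prod_list (map (\<lambda>a. [:- (2 * a), 2:]) ts)"

text \<open>A divided difference splits off the first node, and the remaining list is applied to the
  quotient. Each \<open>d k\<close> that occurs is a value of an absolutely monotone function, hence
  nonnegative. Repeated nodes give Hermite interpolation.\<close>

lemma real_am_newton:
  assumes "real_am g" "set ts \<subseteq> {-1..<1}"
  shows "\<exists>d r. real_am r \<and> (\<forall>k. 0 \<le> d k) \<and> (\<forall>t\<in>{-1..<1}.
    g t = poly (\<Sum>k<length ts. smult (d k) (node_poly (take k ts))) t + poly (node_poly ts) t * r t)"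
  using assms
proof (induction ts arbitrary: g)
  case Nil
  then show ?case
    by (intro exI[of _ "\<lambda>_. 0"] exI[of _ g]) (auto simp: node_poly_def)
next
  case (Cons a ts)
  have a: "a \<in> {-1..<1}" using Cons.prems by simp
  obtain q where q: "real_am q" "\<And>t. t \<in> {-1..<1} \<Longrightarrow> g t = g a + (2 * t - 2 * a) * q t"
    using real_am_divided_difference[OF Cons.prems(1) a] by blast
  obtain d r where r: "real_am r" "\<And>k. 0 \<le> d k"
    and e: "\<And>t. t \<in> {-1..<1} \<Longrightarrow>
      q t = poly (\<Sum>k<length ts. smult (d k) (node_poly (take k ts))) t + poly (node_poly ts) t * r t"
    using Cons.IH[OF q(1)] Cons.prems(2) by (metis insert_subset list.simps(15))
  define d' where "d' = case_nat (g a) d"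
  have "g t = poly (\<Sum>k<length (a # ts). smult (d' k) (node_poly (take k (a # ts)))) t
      + poly (node_poly (a # ts)) t * r t" if t: "t \<in> {-1..<1}" for t
  proof -
    have A: "poly (\<Sum>k<length (a # ts). smult (d' k) (node_poly (take k (a # ts)))) t =
        g a + (2 * t - 2 * a) * (\<Sum>k<length ts. d k * poly (node_poly (take k ts)) t)"
      by (simp add: sum.lessThan_Suc_shift poly_sum d'_def node_poly_def sum_distrib_left algebra_simps
          del: sum.lessThan_Suc)
    have B: "poly (node_poly (a # ts)) t = (2 * t - 2 * a) * poly (node_poly ts) t"
      by (simp add: node_poly_def algebra_simps)
    have "g t = g a + (2 * t - 2 * a) * ((\<Sum>k<length ts. d k * poly (node_poly (take k ts)) t)
        + poly (node_poly ts) t * r t)"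
      using q(2)[OF t] e[OF t] by (simp add: poly_sum)
    then show ?thesis
      unfolding A B by (simp add: algebra_simps)
  qed
  moreover have "\<forall>k. 0 \<le> d' k"
    using r(2) real_am_nonneg[OF Cons.prems(1) a] by (auto simp: d'_def split: nat.split)
  ultimately show ?case using r(1) by blast
qed

section \<open>Newton polynomials at the doubled nodes\<close>

definition golden :: real where
  "golden = (1 + sqrt 5) / 2"

lemma golden_square: "golden * golden = golden + 1"
  by (simp add: golden_def field_simps)

text \<open>Ratios of consecutive Fibonacci numbers; this precision suffices for every sign check
  below.\<close>

lemma golden_bounds: "8 / 5 \<le> golden" "golden \<le> 13 / 8"
proof -
  have "11 / 5 \<le> sqrt 5" by (rule real_le_rsqrt) (simp add: power2_eq_square)
  moreover have "sqrt 5 \<le> 9 / 4" by (rule real_le_lsqrt) (simp_all add: power2_eq_square)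
  ultimately show "8 / 5 \<le> golden" "golden \<le> 13 / 8" by (simp_all add: golden_def)
qed

text \<open>The pair \<open>(a, b)\<close> encodes \<open>a + b \<phi>\<close> with \<open>\<phi>\<close> the golden ratio.\<close>
type_synonym zgolden = "int \<times> int"

definition zval :: "zgolden \<Rightarrow> real" where
  "zval z = of_int (fst z) + of_int (snd z) * golden"

definition zadd :: "zgolden \<Rightarrow> zgolden \<Rightarrow> zgolden" where
  "zadd z w = (fst z + fst w, snd z + snd w)"

definition zmul :: "zgolden \<Rightarrow> zgolden \<Rightarrow> zgolden" where
  "zmul z w = (fst z * fst w + snd z * snd w, fst z * snd w + snd z * fst w + snd z * snd w)"

definition zint :: "int \<Rightarrow> zgolden" where
  "zint n = (n, 0)"

definition znonneg :: "zgolden \<Rightarrow> bool" where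
  "znonneg z \<longleftrightarrow> 0 \<le> 5 * fst z + 8 * snd z \<and> 0 \<le> 8 * fst z + 13 * snd z"

lemma zval_add [simp]: "zval (zadd z w) = zval z + zval w"
  by (simp add: zval_def zadd_def algebra_simps)

lemma zval_mul [simp]: "zval (zmul z w) = zval z * zval w"
proof -
  have "zval z * zval w = of_int (fst z * fst w) + of_int (fst z * snd w + snd z * fst w) * golden
      + of_int (snd z * snd w) * (golden * golden)"
    by (simp add: zval_def algebra_simps)
  then show ?thesis
    by (simp add: golden_square zval_def zmul_def algebra_simps)
qed

lemma zval_int [simp]: "zval (zint n) = of_int n"
  by (simp add: zval_def zint_def)

text \<open>A linear function that is nonnegative at both ends of \<open>[8/5, 13/8]\<close> is
  nonnegative at \<open>golden\<close>.\<close>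
lemma zval_nonneg:
  assumes "znonneg z"
  shows "0 \<le> zval z"
proof (cases "0 \<le> snd z")
  case True
  then have "of_int (snd z) * (8 / 5) \<le> of_int (snd z) * golden"
    using golden_bounds by (intro mult_left_mono) auto
  moreover have "0 \<le> (5 * of_int (fst z) + 8 * of_int (snd z) :: real)"
    using assms unfolding znonneg_def by linarith
  ultimately show ?thesis by (simp add: zval_def)
next
  case False
  then have "of_int (snd z) * (13 / 8) \<le> of_int (snd z) * golden"
    using golden_bounds by (intro mult_left_mono_neg) auto
  moreover have "0 \<le> (8 * of_int (fst z) + 13 * of_int (snd z) :: real)"
    using assms unfolding znonneg_def by linarith
  ultimately show ?thesis by (simp add: zval_def)
qed

section \<open>Coefficient lists in the basis \<open>cheb_U\<close>\<close>

fun ladd :: "zgolden list \<Rightarrow> zgolden list \<Rightarrow> zgolden list" where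
  "ladd [] ys = ys"
| "ladd xs [] = xs"
| "ladd (x # xs) (y # ys) = zadd x y # ladd xs ys"

definition lscale :: "zgolden \<Rightarrow> zgolden list \<Rightarrow> zgolden list" where
  "lscale c xs = map (zmul c) xs"

text \<open>Multiplication by 2t sends U_i to U_(i-1) + U_(i+1), with U_(-1) = 0: the list is
  shifted both ways and the results are added.\<close>

definition lX :: "zgolden list \<Rightarrow> zgolden list" where
  "lX xs = ladd (zint 0 # xs) (tl xs)"

definition lfactor :: "zgolden \<Rightarrow> zgolden list \<Rightarrow> zgolden list" where
  "lfactor c xs = ladd (lX xs) (lscale (zmul (zint (- 1)) c) xs)"

text \<open>The default zero past the end lets a finite list stand for the coefficients in all
  degrees.\<close>

fun lnth :: "zgolden list \<Rightarrow> nat \<Rightarrow> zgolden" where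
  "lnth [] i = zint 0"
| "lnth (x # xs) 0 = x"
| "lnth (x # xs) (Suc i) = lnth xs i"

lemma zval_lnth_ladd [simp]: "zval (lnth (ladd xs ys) i) = zval (lnth xs i) + zval (lnth ys i)"
proof (induction xs ys arbitrary: i rule: ladd.induct)
  case (3 x xs y ys)
  then show ?case by (cases i) auto
qed auto

lemma zval_lnth_lscale [simp]: "zval (lnth (lscale c xs) i) = zval c * zval (lnth xs i)"
proof (induction xs arbitrary: i)
  case (Cons x xs)
  then show ?case by (cases i) (auto simp: lscale_def)
qed (auto simp: lscale_def)

lemma lnth_tl: "lnth (tl xs) i = lnth xs (Suc i)"
  by (cases xs) auto

lemma lnth_in: "list_all P xs \<Longrightarrow> P (zint 0) \<Longrightarrow> P (lnth xs i)"
proof (induction xs arbitrary: i)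
  case (Cons x xs)
  then show ?case by (cases i) auto
qed auto

definition represents :: "zgolden list \<Rightarrow> real poly \<Rightarrow> bool" where
  "represents xs p \<longleftrightarrow> (\<forall>i. ucoef p i = zval (lnth xs i))"

lemma represents_1: "represents [zint 1] 1"
proof -
  have "ucoef 1 i = zval (lnth [zint 1] i)" for i
    using ucoef_cheb_U[of 0 i] by (cases i) auto
  then show ?thesis by (simp add: represents_def)
qed

lemma represents_add: "represents xs p \<Longrightarrow> represents ys q \<Longrightarrow> represents (ladd xs ys) (p + q)"
  by (simp add: represents_def)

lemma represents_scale: "represents xs p \<Longrightarrow> represents (lscale c xs) (smult (zval c) p)"
  by (simp add: represents_def)

lemma represents_X:
  assumes "represents xs p"
  shows "represents (lX xs) ([:0, 2:] * p)"
  unfolding represents_def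
proof
  fix i show "ucoef ([:0, 2:] * p) i = zval (lnth (lX xs) i)"
    using assms ucoef_X_0[of p] ucoef_X_Suc[of p]
    by (cases i) (simp_all add: represents_def lX_def lnth_tl)
qed

lemma represents_factor:
  assumes "represents xs p"
  shows "represents (lfactor c xs) ([:- zval c, 2:] * p)"
proof -
  have "[:- zval c, 2:] * p = [:0, 2:] * p + smult (zval (zmul (zint (- 1)) c)) p"
    by (simp add: algebra_simps)
  then show ?thesis
    unfolding lfactor_def
    using represents_add[OF represents_X[OF assms] represents_scale[OF assms]] by metis
qed

primrec lnodes :: "zgolden list \<Rightarrow> zgolden list" where
  "lnodes [] = [zint 1]"
| "lnodes (z # zs) = lfactor z (lnodes zs)"

lemma represents_lnodes: "represents (lnodes zs) (node_poly (map (\<lambda>z. zval z / 2) zs))"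
  by (induction zs) (use represents_1 represents_factor in \<open>auto simp: node_poly_def\<close>)

text \<open>Twice the nodes, in increasing order. As -1 comes first, \<open>tl\<close> affects this
  node alone, here and in \<open>zdouble\<close>.\<close>

definition znodes :: "zgolden list" where
  "znodes = [(-2, 0), (0, -1), (-1, 0), (1, -1), (0, 0), (-1, 1), (1, 0), (0, 1)]"

definition zdouble :: "zgolden list" where
  "zdouble = concat (map (\<lambda>z. [z, z]) znodes)"

definition gnodes :: "real list" where
  "gnodes = map (\<lambda>z. zval z / 2) zdouble"

definition newton :: "nat \<Rightarrow> real poly" where
  "newton k = node_poly (take k gnodes)"

text \<open>The tail drops one of the two copies of -1: the derivative of a feasible polynomial may
  fall below that of \<open>h\<close> at this endpoint, so only a simple zero is prescribed
  there.\<close>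

definition Wpoly :: "real poly" where
  "Wpoly = node_poly (tl gnodes)"

text \<open>The parameters are the coefficients in powers of 2t, so that multiplication by it
  translates to \<open>lX\<close>.\<close>

definition quad :: "real \<Rightarrow> real \<Rightarrow> real \<Rightarrow> real poly" where
  "quad a b c = [:a, 2 * b, 4 * c:]"

primrec lprefixes :: "zgolden list \<Rightarrow> zgolden list \<Rightarrow> zgolden list list" where
  "lprefixes xs [] = []"
| "lprefixes xs (z # zs) = xs # lprefixes (lfactor z xs) zs"

fun zdot :: "int list \<Rightarrow> zgolden list \<Rightarrow> zgolden" where
  "zdot (n # ns) (x # xs) = zadd (zmul (zint n) x) (zdot ns xs)"
| "zdot _ _ = zint 0"

text \<open>For a Newton polynomial \<open>p\<close> with coefficient list \<open>xs\<close>, a corner of the optimal triangle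
  contributes \<open>p + Wpoly * r / N\<close>, where the coefficients of the quadratic polynomial \<open>r\<close> are
  obtained by applying the matrix \<open>q\<close> to the coefficients of \<open>p\<close> in degrees 11, 12, 13.\<close>
definition corner_quad :: "int list list \<Rightarrow> zgolden list \<Rightarrow> zgolden list" where
  "corner_quad q xs = map (\<lambda>n. zdot n [lnth xs 11, lnth xs 12, lnth xs 13]) q"

definition corner_list :: "int \<Rightarrow> zgolden list \<Rightarrow> zgolden list \<Rightarrow> zgolden list \<Rightarrow> zgolden list" where
  "corner_list N W xs a = ladd (lscale (zint N) xs)
     (ladd (lscale (a ! 0) W) (ladd (lscale (a ! 1) (lX W)) (lscale (a ! 2) (lX (lX W)))))"

text \<open>The list \<open>a\<close> holds the coefficients of \<open>r\<close> in powers of 2t.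
  The \<open>znonneg\<close> tests on it ask for a nonnegative leading coefficient and nonpositive
  values at t = 1 and t = -1; by convexity \<open>r\<close> is then nonpositive on [-1,1].\<close>

definition corner_check_lists :: "nat list \<Rightarrow> bool \<Rightarrow> zgolden list \<Rightarrow> zgolden list \<Rightarrow> bool" where
  "corner_check_lists Z e a ys \<longleftrightarrow> list_all znonneg ys \<and> list_all (\<lambda>i. lnth ys i = zint 0) Z \<and>
     znonneg (zdot [0, 0, 1] a) \<and> znonneg (zdot [-1, 2, -4] a) \<and> znonneg (zdot [-1, -2, -4] a) \<and>
     (e \<longrightarrow> zdot [-1, 2, -4] a = zint 0)"

definition corner_check_newton ::
    "int \<Rightarrow> int list list \<Rightarrow> nat list \<Rightarrow> bool \<Rightarrow> zgolden list \<Rightarrow> zgolden list \<Rightarrow> bool" where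
  "corner_check_newton N q Z e W xs \<longleftrightarrow>
     corner_check_lists Z e (corner_quad q xs) (corner_list N W xs (corner_quad q xs))"

definition corner_check :: "int \<Rightarrow> int list list \<Rightarrow> nat list \<Rightarrow> bool \<Rightarrow> bool" where
  "corner_check N q Z e \<longleftrightarrow> 0 < N \<and>
     list_all (corner_check_newton N q Z e (lnodes (tl zdouble))) (lprefixes [zint 1] zdouble)"

text \<open>The matrices solve, up to the factor \<open>N\<close>, the linear systems (see \<open>ucoef_Wpoly_quad\<close>) saying
  that the coefficients of the corner in the degrees \<open>Z\<close> vanish and, if \<open>e\<close>, that \<open>r\<close> vanishes at
  \<open>2t = -2\<close>.\<close>
lemma corner_check_1:
  "corner_check 156 [[-96, 150, 0], [-4, 3, 0], [22, -36, 0]] [11, 12] True"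
  by code_simp

lemma corner_check_2:
  "corner_check 116 [[0, -110, 192], [0, -7, 8], [0, 24, -44]] [12, 13] True"
  by code_simp

lemma corner_check_3:
  "corner_check 180 [[-84, 90, 72], [11, -45, 42], [12, 0, -36]] [11, 12, 13] False"
  by code_simp

lemma lprefixes_represents:
  assumes "represents xs p" "k < length zs"
  shows "represents (lprefixes xs zs ! k) (node_poly (map (\<lambda>z. zval z / 2) (take k zs)) * p)"
  using assms
proof (induction zs arbitrary: xs p k)
  case (Cons z zs)
  show ?case
  proof (cases k)
    case 0
    then show ?thesis using Cons.prems by (simp add: node_poly_def)
  next
    case (Suc j)
    have "represents (lprefixes (lfactor z xs) zs ! j)
        (node_poly (map (\<lambda>z. zval z / 2) (take j zs)) * ([:- zval z, 2:] * p))"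
      using Cons Suc by (intro Cons.IH represents_factor) auto
    moreover have "node_poly (map (\<lambda>z. zval z / 2) (take j zs)) * ([:- zval z, 2:] * p) =
        node_poly (map (\<lambda>z. zval z / 2) (take k (z # zs))) * p"
      by (simp add: node_poly_def Suc mult_ac del: mult_pCons_left mult_pCons_right)
    ultimately show ?thesis by (simp add: Suc del: mult_pCons_left mult_pCons_right)
  qed
qed auto

lemma length_lprefixes: "length (lprefixes xs zs) = length zs"
  by (induction zs arbitrary: xs) auto

lemma length_zdouble: "length zdouble = 16"
  by (simp add: zdouble_def znodes_def)

lemma length_gnodes: "length gnodes = 16"
  by (simp add: gnodes_def length_zdouble)

section \<open>The design property of the 600-cell\<close>

text \<open>The number of points of the 600-cell at inner product \<open>gamma600 j\<close> with a given point.\<close>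
definition mult600 :: "nat \<Rightarrow> real" where
  "mult600 j = [1, 12, 20, 12, 30, 12, 20, 12] ! (j - 1)"

definition node_sum :: "(real \<Rightarrow> real) \<Rightarrow> real" where
  "node_sum g = (\<Sum>j\<in>{1..8}. mult600 j * g (gamma600 j))"

text \<open>Sum of U_i over the inner products of one point with all 120 points; the value at 1
  comes from the point itself.\<close>

definition design_sum :: "nat \<Rightarrow> real" where
  "design_sum i = poly (cheb_U i) 1 + node_sum (poly (cheb_U i))"

lemma atLeastAtMost_1_8: "{1..8::nat} = {1, 2, 3, 4, 5, 6, 7, 8}"
  by auto

lemma mult600_pos: "j \<in> {1..8} \<Longrightarrow> 0 < mult600 j"
  unfolding atLeastAtMost_1_8 by (auto simp: mult600_def)

lemma gamma600_eq:
  "gamma600 1 = -1" "gamma600 2 = - golden / 2" "gamma600 3 = - (1 / 2)" "gamma600 4 = (1 - golden) / 2"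
  "gamma600 5 = 0" "gamma600 6 = (golden - 1) / 2" "gamma600 7 = 1 / 2" "gamma600 8 = golden / 2"
  by (simp_all add: gamma600_def golden_def field_simps)

text \<open>The state is (x, U_n(x/2), U_(n+1)(x/2)), so that each further degree costs one step of
  the recurrence.\<close>

definition zstep :: "zgolden \<times> zgolden \<times> zgolden \<Rightarrow> zgolden \<times> zgolden \<times> zgolden" where
  "zstep s = (fst s, snd (snd s), zadd (zmul (fst s) (snd (snd s))) (zmul (zint (- 1)) (fst (snd s))))"

primrec cheb_state :: "zgolden \<Rightarrow> nat \<Rightarrow> zgolden \<times> zgolden \<times> zgolden" where
  "cheb_state x 0 = (x, zint 1, x)"
| "cheb_state x (Suc n) = zstep (cheb_state x n)"

lemma cheb_state:
  "fst (cheb_state x n) = x"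
  "zval (fst (snd (cheb_state x n))) = poly (cheb_U n) (zval x / 2)"
  "zval (snd (snd (cheb_state x n))) = poly (cheb_U (Suc n)) (zval x / 2)"
proof -
  have "fst (cheb_state x n) = x \<and> zval (fst (snd (cheb_state x n))) = poly (cheb_U n) (zval x / 2) \<and>
    zval (snd (snd (cheb_state x n))) = poly (cheb_U (Suc n)) (zval x / 2)"
    by (induction n) (auto simp: zstep_def)
  then show "fst (cheb_state x n) = x"
    "zval (fst (snd (cheb_state x n))) = poly (cheb_U n) (zval x / 2)"
    "zval (snd (snd (cheb_state x n))) = poly (cheb_U (Suc n)) (zval x / 2)" by auto
qed

lemma poly_cheb_U_add:
  assumes "poly (cheb_U m) x = poly (cheb_U 0) x" "poly (cheb_U (Suc m)) x = poly (cheb_U (Suc 0)) x"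
  shows "poly (cheb_U (n + m)) x = poly (cheb_U n) x"
  using assms by (induction n rule: cheb_U.induct) auto

lemma poly_cheb_U_minus_1: "poly (cheb_U n) (- 1) = (- 1) ^ n * (real n + 1)"
  by (induction n rule: cheb_U.induct) (auto simp: algebra_simps)

definition cheb_periodic :: "zgolden \<Rightarrow> bool" where
  "cheb_periodic z \<longleftrightarrow> cheb_state z 60 = cheb_state z 0"

text \<open>These nodes are cosines of multiples of pi/5, pi/3 and pi/2, where U_n has periods
  dividing 10, 6 and 4. Two consecutive values determine the recurrence, so one computation at
  degree 60 suffices.\<close>

lemma cheb_U_period_60:
  assumes "z \<in> set (tl znodes)"
  shows "poly (cheb_U (n + 60)) (zval z / 2) = poly (cheb_U n) (zval z / 2)"
proof (rule poly_cheb_U_add)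
  have "list_all cheb_periodic (tl znodes)"
    by code_simp
  then have *: "cheb_state z 60 = cheb_state z 0" using assms by (simp add: list_all_iff cheb_periodic_def)
  show "poly (cheb_U 60) (zval z / 2) = poly (cheb_U 0) (zval z / 2)"
    "poly (cheb_U (Suc 60)) (zval z / 2) = poly (cheb_U (Suc 0)) (zval z / 2)"
    using cheb_state(2,3)[of z 60] cheb_state(2,3)[of z 0] unfolding * by simp_all
qed

definition state_sum :: "(zgolden \<times> zgolden \<times> zgolden) list \<Rightarrow> zgolden" where
  "state_sum st = zdot [1, 1, 12, 20, 12, 30, 12, 20, 12] (map (\<lambda>s. fst (snd s)) st)"

primrec state_sums :: "nat \<Rightarrow> (zgolden \<times> zgolden \<times> zgolden) list \<Rightarrow> zgolden list" where
  "state_sums 0 st = []"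
| "state_sums (Suc n) st = state_sum st # state_sums n (map zstep st)"

lemma length_state_sums: "length (state_sums n st) = n"
  by (induction n arbitrary: st) auto

lemma nth_state_sums:
  "i < n \<Longrightarrow> state_sums n (map (\<lambda>x. cheb_state x k) xs) ! i = state_sum (map (\<lambda>x. cheb_state x (k + i)) xs)"
proof (induction n arbitrary: i k)
  case (Suc n)
  have "map zstep (map (\<lambda>x. cheb_state x k) xs) = map (\<lambda>x. cheb_state x (Suc k)) xs" by simp
  then show ?case using Suc.prems Suc.IH[of "i - 1" "Suc k"] by (cases i) (auto simp del: map_map)
qed simp

lemma zval_state_sum:
  "zval (state_sum (map (\<lambda>x. cheb_state x i) ((2, 0) # znodes))) = design_sum i"
proof -
  have "zval (2, 0) / 2 = 1" "zval (-2, 0) / 2 = -1" "zval (0, -1) / 2 = - golden / 2"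
    "zval (-1, 0) / 2 = - (1 / 2)" "zval (1, -1) / 2 = (1 - golden) / 2" "zval (0, 0) / 2 = 0"
    "zval (-1, 1) / 2 = (golden - 1) / 2" "zval (1, 0) / 2 = 1 / 2" "zval (0, 1) / 2 = golden / 2"
    by (simp_all add: zval_def)
  then show ?thesis
    unfolding design_sum_def node_sum_def atLeastAtMost_1_8
    by (simp add: state_sum_def znodes_def cheb_state gamma600_eq mult600_def del: One_nat_def)
qed

lemma design_sum_eq_nth:
  "i < n \<Longrightarrow> design_sum i = zval (state_sums n (map (\<lambda>x. cheb_state x 0) ((2, 0) # znodes)) ! i)"
  using nth_state_sums[of i n 0 "(2, 0) # znodes"] zval_state_sum[of i] by simp

text \<open>Only the values at 1 and -1 change; they add up to (i + 1)(1 + (-1)^i), which does not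
  decrease when \<open>i\<close> grows by 60.\<close>

lemma design_sum_add_60: "design_sum i \<le> design_sum (i + 60)"
proof -
  have "poly (cheb_U (i + 60)) (gamma600 j) = poly (cheb_U i) (gamma600 j)" if "j \<in> {2..8}" for j
  proof -
    have "\<exists>z\<in>set (tl znodes). gamma600 j = zval z / 2"
    proof -
      have "j \<in> {2, 3, 4, 5, 6, 7, 8}" using that by auto
      then show ?thesis
        by (auto simp: gamma600_eq znodes_def zval_def)
    qed
    then show ?thesis using cheb_U_period_60 by metis
  qed
  then have "(\<Sum>j\<in>{2..8}. mult600 j * poly (cheb_U (i + 60)) (gamma600 j)) =
      (\<Sum>j\<in>{2..8}. mult600 j * poly (cheb_U i) (gamma600 j))"
    by (intro sum.cong) auto
  moreover have "{1..8::nat} = insert 1 {2..8}" by auto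
  moreover have "poly (cheb_U i) 1 + poly (cheb_U i) (- 1) \<le> poly (cheb_U (i + 60)) 1 + poly (cheb_U (i + 60)) (- 1)"
    unfolding poly_cheb_U_1 poly_cheb_U_minus_1 power_add
    by (cases "even i") (auto simp: algebra_simps)
  ultimately show ?thesis
    by (simp add: design_sum_def node_sum_def mult600_def gamma600_eq del: One_nat_def)
qed

text \<open>\<open>design_sum i / 120\<close> is the dimension of the space of invariants of
  the binary icosahedral group in the \<open>i\<close>-th symmetric power of its natural representation.\<close>
lemma design_sum_nonneg: "0 \<le> design_sum i"
proof (induction i rule: less_induct)
  case (less i)
  show ?case
  proof (cases "i < 60")
    case True
    \<comment> \<open>The degrees below 60 are evaluated exactly; all others reduce to them.\<close>
    have "list_all znonneg (state_sums 60 (map (\<lambda>x. cheb_state x 0) ((2, 0) # znodes)))"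
      by code_simp
    then show ?thesis
      using True by (simp add: design_sum_eq_nth zval_nonneg list_all_length length_state_sums)
  next
    case False
    then have "design_sum (i - 60) \<le> design_sum i"
      using design_sum_add_60[of "i - 60"] by simp
    then show ?thesis using less.IH[of "i - 60"] False by simp
  qed
qed

text \<open>Degrees 1 to 11 express that the 600-cell is a spherical 11-design; up to 17, degree 12
  is the only failure.\<close>

lemma design_sum_values:
  "design_sum 0 = 120" "design_sum 12 = 120" "1 \<le> i \<Longrightarrow> i \<le> 17 \<Longrightarrow> i \<noteq> 12 \<Longrightarrow> design_sum i = 0"
proof -
  have eq: "state_sums 18 (map (\<lambda>x. cheb_state x 0) ((2, 0) # znodes)) =
    map zint [120, 0, 0, 0, 0, 0, 0, 0, 0, 0, 0, 0, 120, 0, 0, 0, 0, 0]"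
    by code_simp
  then have *: "design_sum i = of_int ([120, 0, 0, 0, 0, 0, 0, 0, 0, 0, 0, 0, 120, 0, 0, 0, 0, 0] ! i)"
    if "i < 18" for i
    unfolding design_sum_eq_nth[OF that] eq using that by (subst nth_map) simp_all
  show "design_sum 0 = 120" "design_sum 12 = 120" using *[of 0] *[of 12] by simp_all
  assume i: "1 \<le> i" "i \<le> 17" "i \<noteq> 12"
  then have "i \<in> {1, 2, 3, 4, 5, 6, 7, 8, 9, 10, 11, 13, 14, 15, 16, 17}"
    unfolding insert_iff empty_iff by presburger
  then show "design_sum i = 0" using *[of i] by auto
qed

text \<open>A quadrature rule over the 600-cell with its exact error; up to degree 17 only the
  coefficient of degree 12 contributes to the error.\<close>

lemma quadrature:
  assumes "degree p \<le> n"
  shows "poly p 1 + node_sum (poly p) = 120 * ucoef p 0 + (\<Sum>i=1..n. ucoef p i * design_sum i)"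
proof -
  have "poly p t = (\<Sum>i\<le>n. ucoef p i * poly (cheb_U i) t)" for t
    by (subst cheb_U_expansion[OF assms]) (simp add: poly_sum)
  then have "poly p 1 + node_sum (poly p) = (\<Sum>i\<le>n. ucoef p i * poly (cheb_U i) 1) +
      (\<Sum>j\<in>{1..8}. \<Sum>i\<le>n. ucoef p i * (mult600 j * poly (cheb_U i) (gamma600 j)))"
    by (simp add: node_sum_def sum_distrib_left mult_ac)
  also have "\<dots> = (\<Sum>i\<le>n. ucoef p i * design_sum i)"
    by (subst sum.swap) (simp add: design_sum_def node_sum_def sum_distrib_left distrib_left sum.distrib)
  also have "\<dots> = 120 * ucoef p 0 + (\<Sum>i=1..n. ucoef p i * design_sum i)"
    by (simp add: atMost_atLeast0 sum.atLeast_Suc_atMost design_sum_values)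
  finally show ?thesis .
qed

lemma LP_value_eq: "LP_value 120 p = 120 * (120 * ucoef p 0 - poly p 1)"
  by (simp add: LP_value_def ucoef_def)

section \<open>The factor through all nodes\<close>

text \<open>Dividing out a power of one linear factor leaves the order at the other roots
  unchanged.\<close>

lemma prod_linear_powers_dvd:
  fixes p :: "real poly"
  assumes "finite J" "inj_on a J" "\<And>j. j \<in> J \<Longrightarrow> [:- a j, 1:] ^ n j dvd p"
  shows "(\<Prod>j\<in>J. [:- a j, 1:] ^ n j) dvd p"
  using assms
proof (induction J arbitrary: p rule: finite_induct)
  case (insert i J)
  obtain q where q: "p = [:- a i, 1:] ^ n i * q"
    using insert.prems(2)[of i] by auto
  have "[:- a j, 1:] ^ n j dvd q" if j: "j \<in> J" for j
  proof (cases "q = 0")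
    case False
    have ne: "a j \<noteq> a i" using insert.prems(1) insert.hyps j by (auto simp: inj_on_def)
    have p0: "p \<noteq> 0" using False q by auto
    have "n j \<le> order (a j) p"
      using insert.prems(2)[of j] j p0 by (simp add: order_divides)
    also have "order (a j) p = order (a j) ([:- a i, 1:] ^ n i) + order (a j) q"
      using p0 q by (simp add: order_mult)
    also have "order (a j) ([:- a i, 1:] ^ n i) = 0"
      using ne by (intro order_0I) simp
    finally show ?thesis by (simp add: order_divides)
  qed auto
  then have "(\<Prod>j\<in>J. [:- a j, 1:] ^ n j) dvd q"
    using insert.prems(1) by (intro insert.IH) auto
  then show ?case
    using insert.hyps by (simp add: q del: mult_pCons_left mult_pCons_right)
qed auto

lemma double_root_dvd:
  fixes p :: "real poly"
  assumes "poly p a = 0" "poly (pderiv p) a = 0"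
  shows "[:- a, 1:]\<^sup>2 dvd p"
proof -
  obtain q where q: "p = [:- a, 1:] * q" using assms(1) by (auto simp: poly_eq_0_iff_dvd)
  have "poly q a = 0"
    using assms(2) by (simp add: q pderiv_mult pderiv_pCons del: mult_pCons_left)
  then obtain s where s: "q = [:- a, 1:] * s" by (auto simp: poly_eq_0_iff_dvd)
  have "p = [:- a, 1:]\<^sup>2 * s" by (simp only: q s power2_eq_square mult.assoc)
  then show ?thesis by (rule dvdI)
qed

lemma degree_node_poly: "degree (node_poly ts) = length ts"
  and node_poly_nonzero: "node_poly ts \<noteq> 0"
proof -
  have "degree (node_poly ts) = length ts \<and> node_poly ts \<noteq> 0"
  proof (induction ts)
    case (Cons a ts)
    have "node_poly (a # ts) = [:- (2 * a), 2:] * node_poly ts" by (simp add: node_poly_def)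
    then show ?case using Cons by (subst degree_mult_eq | simp del: mult_pCons_left)+
  qed (simp add: node_poly_def)
  then show "degree (node_poly ts) = length ts" "node_poly ts \<noteq> 0" by auto
qed

definition Spoly :: "real poly" where
  "Spoly = (\<Prod>j\<in>{2..8}. [:- (2 * gamma600 j), 2:])"

lemma gamma600_range: "j \<in> {1..8} \<Longrightarrow> gamma600 j \<in> {-1..<1}"
  and gamma600_interior: "j \<in> {2..8} \<Longrightarrow> gamma600 j \<in> {-1<..<1}"
  and inj_on_gamma600: "inj_on gamma600 {1..8}"
proof -
  note b = golden_bounds
  have s: "{2..8::nat} = {2, 3, 4, 5, 6, 7, 8}" by auto
  show "j \<in> {2..8} \<Longrightarrow> gamma600 j \<in> {-1<..<1}"
    unfolding s using b by (auto simp: gamma600_eq simp del: One_nat_def)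
  show "j \<in> {1..8} \<Longrightarrow> gamma600 j \<in> {-1..<1}"
    unfolding atLeastAtMost_1_8 using b by (auto simp: gamma600_eq simp del: One_nat_def)
  show "inj_on gamma600 {1..8}"
    unfolding atLeastAtMost_1_8 using b by (simp add: gamma600_eq inj_on_def del: One_nat_def)
qed

lemma gnodes_eq: "gnodes = concat (map (\<lambda>j. [gamma600 j, gamma600 j]) [1, 2, 3, 4, 5, 6, 7, 8])"
  by (simp add: gnodes_def zdouble_def znodes_def gamma600_eq zval_def del: One_nat_def)

text \<open>The square makes the sign of \<open>Wpoly\<close> on [-1,1] visible; restoring the
  missing factor at -1 gives the full Hermite node polynomial.\<close>

lemma Wpoly_eq: "Wpoly = [:2, 2:] * Spoly\<^sup>2"
  and node_poly_gnodes: "node_poly gnodes = [:2, 2:] * Wpoly"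
proof -
  have *: "prod_list (map F (tl gnodes)) = F (-1) * (\<Prod>j\<in>{2..8}. F (gamma600 j))\<^sup>2"
    "prod_list (map F gnodes) = F (-1) * prod_list (map F (tl gnodes))" for F :: "real \<Rightarrow> real poly"
  proof -
    have s: "{2..8::nat} = {2, 3, 4, 5, 6, 7, 8}" by auto
    show "prod_list (map F (tl gnodes)) = F (-1) * (\<Prod>j\<in>{2..8}. F (gamma600 j))\<^sup>2"
      "prod_list (map F gnodes) = F (-1) * prod_list (map F (tl gnodes))"
      unfolding s gnodes_eq by (simp_all add: gamma600_eq(1) power2_eq_square mult_ac del: One_nat_def)
  qed
  show "Wpoly = [:2, 2:] * Spoly\<^sup>2" "node_poly gnodes = [:2, 2:] * Wpoly"
    unfolding Wpoly_def node_poly_def Spoly_def * by simp_all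
qed

lemma degree_Wpoly: "degree Wpoly = 15"
  by (simp add: Wpoly_def degree_node_poly length_gnodes)

lemma poly_Spoly: "poly Spoly t = (\<Prod>j\<in>{2..8}. 2 * t - 2 * gamma600 j)"
  by (simp add: Spoly_def poly_prod algebra_simps)

lemma poly_Spoly_eq_0: "j \<in> {2..8} \<Longrightarrow> poly Spoly (gamma600 j) = 0"
  unfolding poly_Spoly by (intro prod_zero) auto

lemma poly_Wpoly: "poly Wpoly t = (2 * t + 2) * (poly Spoly t)\<^sup>2"
  by (simp add: Wpoly_eq algebra_simps)

lemma poly_Wpoly_nonneg: "-1 \<le> t \<Longrightarrow> 0 \<le> poly Wpoly t"
  by (simp add: poly_Wpoly)

lemma poly_Wpoly_gamma600: "j \<in> {1..8} \<Longrightarrow> poly Wpoly (gamma600 j) = 0"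
  using poly_Spoly_eq_0[of j] by (cases "j = 1") (auto simp: poly_Wpoly gamma600_eq(1)[simplified])

lemma poly_pderiv_Wpoly: "j \<in> {2..8} \<Longrightarrow> poly (pderiv Wpoly) (gamma600 j) = 0"
  using poly_Spoly_eq_0[of j] by (simp add: Wpoly_eq pderiv_mult power2_eq_square del: mult_pCons_left)

lemma poly_pderiv_Wpoly_minus_1: "0 < poly (pderiv Wpoly) (- 1)"
proof -
  have "poly (pderiv Wpoly) (- 1) = 2 * (poly Spoly (- 1))\<^sup>2"
    by (simp add: Wpoly_eq pderiv_mult pderiv_pCons power2_eq_square del: mult_pCons_left)
  moreover have "poly Spoly (- 1) \<noteq> 0"
  proof -
    have "gamma600 j \<noteq> - 1" if "j \<in> {2..8}" for j
      using gamma600_interior[OF that] by auto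
    then show ?thesis by (auto simp: poly_Spoly prod_zero_iff)
  qed
  ultimately show ?thesis by simp
qed

lemma Wpoly_dvd:
  assumes "\<And>j. j \<in> {1..8} \<Longrightarrow> poly p (gamma600 j) = 0"
    and "\<And>j. j \<in> {2..8} \<Longrightarrow> poly (pderiv p) (gamma600 j) = 0"
  shows "Wpoly dvd p"
proof -
  \<comment> \<open>The exponent is 1 at the endpoint -1, where no derivative is prescribed.\<close>
  let ?n = "\<lambda>j::nat. if j = 1 then 1 else 2 :: nat"
  have "[:- gamma600 j, 1:] ^ ?n j dvd p" if "j \<in> {1..8}" for j
    using assms(1)[of j] assms(2)[of j] that double_root_dvd[of p "gamma600 j"]
    by (auto simp: poly_eq_0_iff_dvd)
  then have dvd: "(\<Prod>j\<in>{1..8}. [:- gamma600 j, 1:] ^ ?n j) dvd p"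
    by (intro prod_linear_powers_dvd inj_on_gamma600) auto
  have s: "{1..8} = insert 1 {2..8::nat}" by auto
  have f: "[:- (2 * a), 2:] = smult 2 [:- a, 1:]" for a :: real by simp
  have S: "Spoly = smult (2 ^ 7) (\<Prod>j\<in>{2..8}. [:- gamma600 j, 1:])"
    unfolding Spoly_def f prod_smult by simp
  have P: "(\<Prod>j\<in>{1..8}. [:- gamma600 j, 1:] ^ ?n j) = [:1, 1:] * (\<Prod>j\<in>{2..8}. [:- gamma600 j, 1:])\<^sup>2"
    unfolding s by (subst prod.insert) (auto simp: gamma600_eq(1)[simplified] prod_power_distrib intro!: prod.cong)
  have "smult 2 A * (smult (2 ^ 7) Q)\<^sup>2 = smult (2 * 2 ^ 7 * 2 ^ 7) (A * Q\<^sup>2)" for A Q :: "real poly"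
    by (simp add: power2_eq_square)
  moreover have "[:2, 2:] = smult 2 [:1, 1:: real:]" by simp
  ultimately have "Wpoly = smult (2 * 2 ^ 7 * 2 ^ 7) (\<Prod>j\<in>{1..8}. [:- gamma600 j, 1:] ^ ?n j)"
    unfolding Wpoly_eq S P by presburger
  then show ?thesis by (rule ssubst) (rule smult_dvd[OF dvd], simp)
qed

lemma degree_le_2_eq_quad:
  assumes "degree p \<le> 2"
  obtains a b c where "p = quad a b c"
proof -
  have "p = quad (coeff p 0) (coeff p 1 / 2) (coeff p 2 / 4)"
  proof (rule poly_eqI)
    fix n
    show "coeff p n = coeff (quad (coeff p 0) (coeff p 1 / 2) (coeff p 2 / 4)) n"
      using assms by (auto simp: quad_def coeff_pCons coeff_eq_0 numeral_2_eq_2 split: nat.split)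
  qed
  then show thesis by (rule that)
qed

lemma poly_quad: "poly (quad a b c) t = a + b * (2 * t) + c * (2 * t)\<^sup>2"
  by (simp add: quad_def power2_eq_square algebra_simps)

lemma mult_quad: "p * quad a b c = smult a p + (smult b ([:0, 2:] * p) + smult c ([:0, 2:] * ([:0, 2:] * p)))"
  by (simp add: quad_def mult.commute)

lemma represents_Wpoly: "represents (lnodes (tl zdouble)) Wpoly"
  unfolding Wpoly_def gnodes_def map_tl[symmetric] by (rule represents_lnodes)

text \<open>The matrix has determinant 360, so these three coefficients determine the quadratic
  factor.\<close>

lemma ucoef_Wpoly_quad:
  "ucoef (Wpoly * quad a b c) 11 = 18 * a + 36 * b + 78 * c"
  "ucoef (Wpoly * quad a b c) 12 = 10 * a + 24 * b + 48 * c"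
  "ucoef (Wpoly * quad a b c) 13 = 6 * a + 12 * b + 31 * c"
proof -
  let ?W = "lnodes (tl zdouble)"
  have "map (lnth ?W) [11, 12, 13] = map zint [18, 10, 6] \<and>
    map (lnth (lX ?W)) [11, 12, 13] = map zint [36, 24, 12] \<and>
    map (lnth (lX (lX ?W))) [11, 12, 13] = map zint [78, 48, 31]"
    by code_simp
  moreover note r = represents_Wpoly represents_X[OF represents_Wpoly] represents_X[OF represents_X[OF represents_Wpoly]]
  ultimately show "ucoef (Wpoly * quad a b c) 11 = 18 * a + 36 * b + 78 * c"
    "ucoef (Wpoly * quad a b c) 12 = 10 * a + 24 * b + 48 * c"
    "ucoef (Wpoly * quad a b c) 13 = 6 * a + 12 * b + 31 * c"
    unfolding represents_def mult_quad by (simp_all del: mult_pCons_left)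
qed

section \<open>The triangle of optimal polynomials\<close>

text \<open>The polynomial in \<open>expansion\<close> is the Hermite interpolant of \<open>g\<close> at the doubled nodes.\<close>
locale newton_expansion =
  fixes g r :: "real \<Rightarrow> real" and d :: "nat \<Rightarrow> real"
  assumes am_r: "real_am r" and d_nonneg: "\<And>k. 0 \<le> d k"
    and expansion: "\<And>t. t \<in> {-1..<1} \<Longrightarrow>
      g t = poly (\<Sum>k<16. smult (d k) (newton k)) t + poly (node_poly gnodes) t * r t"
begin

definition H :: "real poly" where
  "H = (\<Sum>k<16. smult (d k) (newton k))"

lemma g_eq: "t \<in> {-1..<1} \<Longrightarrow> g t = poly H t + (2 * t + 2) * poly Wpoly t * r t"
  using expansion[of t] by (simp add: H_def node_poly_gnodes algebra_simps)

lemma g_gamma600: "j \<in> {1..8} \<Longrightarrow> g (gamma600 j) = poly H (gamma600 j)"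
  using g_eq[OF gamma600_range] by (simp add: poly_Wpoly_gamma600)

lemma degree_H: "degree H \<le> 15"
  unfolding H_def
proof (rule degree_sum_le)
  show "degree (smult (d k) (newton k)) \<le> 15" if "k \<in> {..<16}" for k
    using that by (intro order_trans[OF degree_smult_le]) (simp add: newton_def degree_node_poly)
qed simp

text \<open>The remainder is \<open>r\<close> times a polynomial with a double zero at every node,
  -1 included, so it contributes nothing to the derivative.\<close>

lemma deriv_g:
  assumes j: "j \<in> {1..8}"
  shows "(g has_real_derivative poly (pderiv H) (gamma600 j)) (at (gamma600 j) within {-1..<1})"
proof -
  let ?a = "gamma600 j" and ?P = "[:2, 2:] * Wpoly"
  have P: "poly ?P ?a = 0" using poly_Wpoly_gamma600[OF j] by simp
  have P': "poly (pderiv ?P) ?a = 0"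
  proof (cases "j = 1")
    case True
    then show ?thesis using poly_Wpoly_gamma600[OF j] gamma600_eq(1)
      by (simp add: pderiv_mult pderiv_pCons del: mult_pCons_left)
  next
    case False
    then show ?thesis using poly_Wpoly_gamma600[OF j] poly_pderiv_Wpoly[of j] j
      by (simp add: pderiv_mult pderiv_pCons del: mult_pCons_left)
  qed
  obtain r' where r': "(r has_real_derivative r') (at ?a within {-1..<1})"
    using real_am_differentiable[OF am_r gamma600_range[OF j]] by blast
  have "((\<lambda>t. poly H t + poly ?P t * r t) has_real_derivative
      poly (pderiv H) ?a + (poly (pderiv ?P) ?a * r ?a + r' * poly ?P ?a)) (at ?a within {-1..<1})"
    by (intro DERIV_add DERIV_mult r' DERIV_subset[OF poly_DERIV]) auto
  then have "((\<lambda>t. poly H t + poly ?P t * r t) has_real_derivative poly (pderiv H) ?a) (at ?a within {-1..<1})"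
    unfolding P P' by simp
  then show ?thesis
    by (rule has_field_derivative_transform_within[where d = 1])
      (use gamma600_range[OF j] in \<open>auto simp: g_eq algebra_simps\<close>)
qed

lemma at_within_Ico_neq_bot: "t \<in> {-1..<1::real} \<Longrightarrow> at t within {-1..<1} \<noteq> bot"
  by (simp add: trivial_limit_within)

lemma deriv_g_iff:
  assumes "j \<in> {1..8}"
  shows "(g has_real_derivative D) (at (gamma600 j) within {-1..<1}) \<longleftrightarrow> D = poly (pderiv H) (gamma600 j)"
  using deriv_g[OF assms] at_within_Ico_neq_bot[OF gamma600_range[OF assms]]
    vector_derivative_unique_within[of "gamma600 j" "{-1..<1}" g]
  by (auto simp: has_real_derivative_iff_has_vector_derivative)

text \<open>\<open>Wpoly\<close> has double zeros at the interior nodes but a simple one at -1,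
  where the derivative moves in proportion to the value a - 2b + 4c of the quadratic.\<close>

lemma corner_interpolates:
  "j \<in> {1..8} \<Longrightarrow> poly (H + Wpoly * quad a b c) (gamma600 j) = g (gamma600 j)"
  "j \<in> {2..8} \<Longrightarrow> poly (pderiv (H + Wpoly * quad a b c)) (gamma600 j) = poly (pderiv H) (gamma600 j)"
  "poly (pderiv (H + Wpoly * quad a b c)) (- 1) =
    poly (pderiv H) (- 1) + poly (pderiv Wpoly) (- 1) * (a - 2 * b + 4 * c)"
  using poly_Wpoly_gamma600[of j] poly_Wpoly_gamma600[of 1] poly_pderiv_Wpoly[of j]
  by (simp_all add: g_gamma600 pderiv_add pderiv_mult poly_quad gamma600_eq(1)[simplified])

lemma eq_H_plus_Wpoly_quad:
  assumes "degree f \<le> 17" "\<And>j. j \<in> {1..8} \<Longrightarrow> poly f (gamma600 j) = g (gamma600 j)"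
    and "\<And>j. j \<in> {2..8} \<Longrightarrow> poly (pderiv f) (gamma600 j) = poly (pderiv H) (gamma600 j)"
  obtains a b c where "f = H + Wpoly * quad a b c"
proof -
  have "Wpoly dvd f - H"
    using assms(2,3) by (intro Wpoly_dvd) (auto simp: g_gamma600 pderiv_diff)
  then obtain s where s: "f - H = Wpoly * s" by blast
  have "degree (f - H) \<le> 17"
    using assms(1) degree_H by (intro degree_diff_le) auto
  then have "degree s \<le> 2"
    using degree_Wpoly degree_mult_eq[of Wpoly s]
    by (cases "s = 0"; cases "Wpoly = 0") (auto simp: s)
  then obtain a b c where "s = quad a b c" by (rule degree_le_2_eq_quad)
  then have "f = H + Wpoly * quad a b c" using s by (simp add: algebra_simps)
  then show thesis by (rule that)
qed

lemma degree_quad: "degree (quad a b c) \<le> 2"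
  by (simp add: quad_def)

lemma degree_H_plus: "degree (H + Wpoly * quad a b c) \<le> 17"
proof (rule degree_add_le)
  show "degree (Wpoly * quad a b c) \<le> 17"
    using degree_mult_le[of Wpoly "quad a b c"] degree_Wpoly degree_quad[of a b c] by linarith
qed (use degree_H in simp)

text \<open>With q the quadratic and W = \<open>Wpoly\<close>, g - (H + W q) = W ((2t + 2) r - q);
  here W and r are nonnegative, and the convex q is nonpositive because its end values are.\<close>

lemma H_plus_le_g:
  assumes "0 \<le> c" "a - 2 * b + 4 * c \<le> 0" "a + 2 * b + 4 * c \<le> 0" and t: "t \<in> {-1..<1}"
  shows "poly (H + Wpoly * quad a b c) t \<le> g t"
proof -
  have "(2 * t)\<^sup>2 \<le> 2\<^sup>2" using t by (intro power2_le_iff_abs_le[THEN iffD2]) (auto simp: abs_if)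
  then have "c * (2 * t)\<^sup>2 \<le> c * 4" using assms(1) by (intro mult_left_mono) auto
  moreover have "b * (2 * t) \<le> 2 * \<bar>b\<bar>"
  proof -
    have "\<bar>b\<bar> * \<bar>t\<bar> \<le> \<bar>b\<bar> * 1" using t by (intro mult_left_mono) auto
    then show ?thesis using abs_ge_self[of "b * t"] by (simp add: abs_mult)
  qed
  ultimately have "poly (quad a b c) t \<le> 0"
    using assms(2,3) by (simp add: poly_quad abs_if split: if_splits)
  moreover have "0 \<le> (2 * t + 2) * r t" using t real_am_nonneg[OF am_r t] by simp
  ultimately have "poly Wpoly t * poly (quad a b c) t \<le> poly Wpoly t * ((2 * t + 2) * r t)"
    using t by (intro mult_left_mono poly_Wpoly_nonneg) auto
  then show ?thesis using g_eq[OF t] by (simp add: mult_ac)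
qed

lemma represents_newton: "k < 16 \<Longrightarrow> represents (lprefixes [zint 1] zdouble ! k) (newton k)"
  using lprefixes_represents[OF represents_1, of k zdouble]
  by (simp add: newton_def gnodes_def take_map length_zdouble)

text \<open>The corner depends linearly on the coefficients \<open>d k\<close>, so the sixteen
  checked cases add up with the nonnegative weights d k / N.\<close>

lemma corner_exists:
  assumes "corner_check N [q0, q1, q2] Z e"
  obtains a b c where "\<And>i. 0 \<le> ucoef (H + Wpoly * quad a b c) i"
    and "\<And>i. i \<in> set Z \<Longrightarrow> ucoef (H + Wpoly * quad a b c) i = 0"
    and "0 \<le> c" "a - 2 * b + 4 * c \<le> 0" "a + 2 * b + 4 * c \<le> 0"
    and "e \<Longrightarrow> a - 2 * b + 4 * c = 0"
proof -
  let ?W = "lnodes (tl zdouble)" and ?q = "[q0, q1, q2]"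
  define xs where "xs = (\<lambda>k. lprefixes [zint 1] zdouble ! k)"
  define z where "z = (\<lambda>k. corner_quad ?q (xs k))"
  define ys where "ys = (\<lambda>k. corner_list N ?W (xs k) (z k))"
  have N: "0 < N" using assms by (simp add: corner_check_def)
  have chk: "corner_check_lists Z e (z k) (ys k)" if "k < 16" for k
    using assms that
    by (simp add: corner_check_def list_all_length length_lprefixes length_zdouble
        corner_check_newton_def xs_def z_def ys_def)
  have z3: "z k = [z k ! 0, z k ! 1, z k ! 2]" for k
    by (simp add: z_def corner_quad_def)
  define w where "w = (\<lambda>k m. zval (z k ! m))"
  have rep: "represents (ys k) (smult (of_int N) (newton k) + Wpoly * quad (w k 0) (w k 1) (w k 2))"
    if "k < 16" for k
    unfolding ys_def corner_list_def mult_quad w_def zval_int[symmetric] xs_def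
    by (intro represents_add represents_scale represents_X represents_Wpoly represents_newton that)
  have z: "zval (zdot [n0, n1, n2] (z k)) = of_int n0 * w k 0 + of_int n1 * w k 1 + of_int n2 * w k 2"
    for n0 n1 n2 k
    by (subst z3) (simp add: w_def)
  define v where "v = (\<lambda>m. (\<Sum>k<16. d k / of_int N * w k m))"
  have F: "H + Wpoly * quad (v 0) (v 1) (v 2) = (\<Sum>k<16. smult (d k / of_int N)
      (smult (of_int N) (newton k) + Wpoly * quad (w k 0) (w k 1) (w k 2)))"
  proof -
    have "quad (v 0) (v 1) (v 2) = (\<Sum>k<16. smult (d k / of_int N) (quad (w k 0) (w k 1) (w k 2)))"
      by (rule poly_eqI) (auto simp: quad_def v_def coeff_sum coeff_pCons sum_distrib_left mult_ac split: nat.split)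
    then show ?thesis
      using N by (simp add: H_def smult_add_right sum.distrib sum_distrib_left)
  qed
  have u: "ucoef (H + Wpoly * quad (v 0) (v 1) (v 2)) i = (\<Sum>k<16. d k / of_int N * zval (lnth (ys k) i))" for i
    unfolding F ucoef_sum ucoef_smult using rep
    by (intro sum.cong refl) (simp add: represents_def)
  have lin: "of_int n0 * v 0 + of_int n1 * v 1 + of_int n2 * v 2 =
      (\<Sum>k<16. d k / of_int N * zval (zdot [n0, n1, n2] (z k)))" for n0 n1 n2
    unfolding z by (simp add: v_def sum_distrib_left algebra_simps flip: sum.distrib)
  have dN: "0 \<le> d k / of_int N" for k using d_nonneg[of k] N by simp
  show thesis
  proof (rule that)
    show "0 \<le> ucoef (H + Wpoly * quad (v 0) (v 1) (v 2)) i" for i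
    proof -
      have "znonneg (zint 0)" by (simp add: znonneg_def zint_def)
      then have "znonneg (lnth (ys k) i)" if "k < 16" for k
        using chk[OF that] by (intro lnth_in[of znonneg]) (simp_all add: corner_check_lists_def)
      then show ?thesis
        unfolding u using dN by (intro sum_nonneg mult_nonneg_nonneg zval_nonneg) auto
    qed
    show "ucoef (H + Wpoly * quad (v 0) (v 1) (v 2)) i = 0" if "i \<in> set Z" for i
      unfolding u using chk that
      by (intro sum.neutral) (auto simp: corner_check_lists_def list_all_iff)
    have nn: "0 \<le> of_int n0 * v 0 + of_int n1 * v 1 + of_int n2 * v 2"
      if "\<And>k. k < 16 \<Longrightarrow> znonneg (zdot [n0, n1, n2] (z k))" for n0 n1 n2
      unfolding lin using that dN by (intro sum_nonneg mult_nonneg_nonneg zval_nonneg) auto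
    show "0 \<le> v 2" using nn[of 0 0 1] chk by (simp add: corner_check_lists_def)
    show "v 0 - 2 * v 1 + 4 * v 2 \<le> 0" using nn[of "-1" 2 "-4"] chk by (simp add: corner_check_lists_def)
    show "v 0 + 2 * v 1 + 4 * v 2 \<le> 0" using nn[of "-1" "-2" "-4"] chk by (simp add: corner_check_lists_def)
    show "v 0 - 2 * v 1 + 4 * v 2 = 0" if e
    proof -
      have "of_int (-1) * v 0 + of_int 2 * v 1 + of_int (-4) * v 2 = 0"
        unfolding lin using chk that by (intro sum.neutral) (auto simp: corner_check_lists_def)
      then show ?thesis by simp
    qed
  qed
qed

end

context newton_expansion
begin

text \<open>The factors 29/90, -1, 13/15 combine the rows of the matrix in
  \<open>ucoef_Wpoly_quad\<close> to (1, -2, 4), which is evaluation of the quadratic at t =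
  -1.\<close>

definition K :: real where
  "K = 29 / 90 * ucoef H 11 - ucoef H 12 + 13 / 15 * ucoef H 13"

lemma ucoef_corner:
  "ucoef (H + Wpoly * quad a b c) 11 = ucoef H 11 + 18 * a + 36 * b + 78 * c"
  "ucoef (H + Wpoly * quad a b c) 12 = ucoef H 12 + 10 * a + 24 * b + 48 * c"
  "ucoef (H + Wpoly * quad a b c) 13 = ucoef H 13 + 6 * a + 12 * b + 31 * c"
  by (simp_all add: ucoef_Wpoly_quad)

lemma triangle_relation:
  assumes "f = H + Wpoly * quad a b c" "ucoef f 12 = 0"
  shows "29 / 90 * ucoef f 11 + 13 / 15 * ucoef f 13 - (a - 2 * b + 4 * c) = K"
  using assms(2) unfolding assms(1) ucoef_corner K_def by (simp add: field_simps)

text \<open>The numbers \<alpha>, \<beta>, \<delta> below are barycentric coordinates with sum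
  \<open>K\<close>. At \<open>f1\<close>, \<open>f2\<close>, \<open>f3\<close> all but \<beta>,
  \<alpha>, \<delta> respectively vanish.\<close>

lemma triangle_convex:
  assumes f: "f = H + Wpoly * quad a b c" "ucoef f 12 = 0" "0 \<le> ucoef f 11" "0 \<le> ucoef f 13"
      "a - 2 * b + 4 * c \<le> 0"
    and f1: "f1 = H + Wpoly * quad a1 b1 c1" "ucoef f1 11 = 0" "ucoef f1 12 = 0" "a1 - 2 * b1 + 4 * c1 = 0"
    and f2: "f2 = H + Wpoly * quad a2 b2 c2" "ucoef f2 12 = 0" "ucoef f2 13 = 0" "a2 - 2 * b2 + 4 * c2 = 0"
    and f3: "f3 = H + Wpoly * quad a3 b3 c3" "ucoef f3 11 = 0" "ucoef f3 12 = 0" "ucoef f3 13 = 0"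
  shows "\<exists>x y z. 0 \<le> x \<and> 0 \<le> y \<and> 0 \<le> z \<and> x + y + z = 1 \<and>
    f = smult x f1 + smult y f2 + smult z f3"
proof -
  define \<alpha> \<beta> \<delta> where "\<alpha> = 29 / 90 * ucoef f 11" and "\<beta> = 13 / 15 * ucoef f 13"
    and "\<delta> = - (a - 2 * b + 4 * c)"
  have nn: "0 \<le> \<alpha>" "0 \<le> \<beta>" "0 \<le> \<delta>" using f by (simp_all add: \<alpha>_def \<beta>_def \<delta>_def)
  have K: "\<alpha> + \<beta> + \<delta> = K"
    using triangle_relation[OF f(1,2)] by (simp add: \<alpha>_def \<beta>_def \<delta>_def)
  have K1: "13 / 15 * ucoef f1 13 = K" using triangle_relation[OF f1(1,3)] f1(2,4) by linarith
  have K2: "29 / 90 * ucoef f2 11 = K" using triangle_relation[OF f2(1,2)] f2(3,4) by linarith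
  \<comment> \<open>If \<open>K = 0\<close>, the triangle is a single point and any weights serve;
    (0, 0, 1) is taken.\<close>
  define x y z where "x = (if K = 0 then 0 else \<beta> / K)" and "y = (if K = 0 then 0 else \<alpha> / K)"
    and "z = (if K = 0 then 1 else \<delta> / K)"
  have K0: "0 \<le> K" using nn K by linarith
  have xyz: "0 \<le> x" "0 \<le> y" "0 \<le> z" "x + y + z = 1" "x * K = \<beta>" "y * K = \<alpha>"
    using nn K K0 by (auto simp: x_def y_def z_def add_divide_distrib[symmetric] add.commute)
  define u v w where "u = x * a1 + y * a2 + z * a3 - a" and "v = x * b1 + y * b2 + z * b3 - b"
    and "w = x * c1 + y * c2 + z * c3 - c"
  define F where "F = smult x f1 + smult y f2 + smult z f3"
  have "smult x H + (smult y H + smult z H) = H"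
    using xyz(4) by (metis add.assoc smult_1_left smult_add_left)
  moreover have "quad (u + a) (v + b) (w + c) = smult x (quad a1 b1 c1) + smult y (quad a2 b2 c2) + smult z (quad a3 b3 c3)"
    by (simp add: quad_def u_def v_def w_def algebra_simps)
  ultimately have F: "F = H + Wpoly * quad (u + a) (v + b) (w + c)"
    unfolding F_def f1(1) f2(1) f3(1) by (simp add: smult_add_right algebra_simps)
  have "ucoef F 11 = y * ucoef f2 11" "ucoef F 12 = 0" "ucoef F 13 = x * ucoef f1 13"
    using f1(2,3) f2(2,3) f3(2-4) by (simp_all add: F_def)
  moreover have "y * ucoef f2 11 = ucoef f 11"
    using xyz(6) unfolding K2[symmetric] \<alpha>_def by simp
  moreover have "x * ucoef f1 13 = ucoef f 13"
    using xyz(5) unfolding K1[symmetric] \<beta>_def by simp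
  ultimately have "ucoef F 11 = ucoef f 11" "ucoef F 12 = ucoef f 12" "ucoef F 13 = ucoef f 13"
    using f(2) by simp_all
  \<comment> \<open>The difference between the combination and \<open>f\<close> solves a homogeneous
    system of determinant 360.\<close>
  then have "18 * u + 36 * v + 78 * w = 0" "10 * u + 24 * v + 48 * w = 0" "6 * u + 12 * v + 31 * w = 0"
    unfolding F f(1) ucoef_corner by (simp_all add: algebra_simps)
  then have "u = 0" "v = 0" "w = 0" by linarith+
  then have "f = F" using F f(1) by simp
  then show ?thesis using xyz unfolding F_def by blast
qed

end

section \<open>The linear program and its bound\<close>

lemma absolutely_monotone_newton:
  assumes "absolutely_monotone h"
  obtains g r d where "newton_expansion g r d" "\<And>t. t \<in> {-1..<1} \<Longrightarrow> h t = ereal (g t)"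
    "g = (\<lambda>t. real_of_ereal (h t))"
proof -
  obtain D :: "nat \<Rightarrow> real \<Rightarrow> real" where D: "\<forall>t\<in>{-1..<1}. h t = ereal (D 0 t)"
    "\<forall>i. \<forall>t\<in>{-1..<1}. (D i has_real_derivative D (Suc i) t) (at t within {-1..<1})"
    "\<forall>i. \<forall>t\<in>{-1..<1}. 0 \<le> D i t"
    using assms unfolding absolutely_monotone_def by blast
  define g where "g = (\<lambda>t. real_of_ereal (h t))"
  have "real_am g" unfolding real_am_def
    by (rule exI[of _ D]) (use D in \<open>auto simp: g_def\<close>)
  moreover have "set gnodes \<subseteq> {-1..<1}"
    using gamma600_range unfolding gnodes_eq by auto
  ultimately obtain d r where "real_am r" "\<forall>k. 0 \<le> d k" "\<forall>t\<in>{-1..<1}.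
    g t = poly (\<Sum>k<length gnodes. smult (d k) (node_poly (take k gnodes))) t + poly (node_poly gnodes) t * r t"
    using real_am_newton[of g gnodes] by blast
  then have "newton_expansion g r d"
    by unfold_locales (auto simp: newton_def length_gnodes)
  moreover have "h t = ereal (g t)" if "t \<in> {-1..<1}" for t
    using D that by (simp add: g_def)
  ultimately show thesis using that g_def by blast
qed

text \<open>The bound at 1 follows by passing to the left limit, also when \<open>h 1\<close> is
  infinite.\<close>

lemma poly_le_absolutely_monotone:
  assumes h: "absolutely_monotone h" and le: "\<And>t. t \<in> {-1..<1} \<Longrightarrow> ereal (poly f t) \<le> h t"
  shows "\<forall>t\<in>{-1..1}. ereal (poly f t) \<le> h t"
proof
  fix t :: real assume "t \<in> {-1..1}"
  then consider "t \<in> {-1..<1}" | "t = 1" by force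
  then show "ereal (poly f t) \<le> h t"
  proof cases
    case 2
    have f: "((\<lambda>t. ereal (poly f t)) \<longlongrightarrow> ereal (poly f 1)) (at_left 1)"
      by (intro tendsto_intros)
    have ev: "\<forall>\<^sub>F t in at_left 1. ereal (poly f t) \<le> h t"
      using eventually_at_left_real[of "-1" 1] by (rule eventually_mono) (auto intro: le)
    have "(h \<longlongrightarrow> h 1) (at_left 1)" using h by (simp add: absolutely_monotone_def)
    from tendsto_le[OF _ this f ev] show ?thesis using 2 by simp
  qed (rule le)
qed

text \<open>Weak duality with the 600-cell as dual solution. Equality forces complementary
  slackness: contact at all nodes, and a vanishing coefficient in degree 12.\<close>

lemma LP_value_le:
  assumes p: "poly p \<in> A4 h" and g: "\<And>j. j \<in> {1..8} \<Longrightarrow> h (gamma600 j) = ereal (g (gamma600 j))"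
  shows "LP_value 120 p \<le> 120 * node_sum g"
    and "LP_value 120 p = 120 * node_sum g \<Longrightarrow> j \<in> {1..8} \<Longrightarrow> poly p (gamma600 j) = g (gamma600 j)"
    and "LP_value 120 p = 120 * node_sum g \<Longrightarrow> ucoef p 12 = 0"
proof -
  \<comment> \<open>The maximum keeps the index 12 inside the sum.\<close>
  define n where "n = max 12 (degree p)"
  define E where "E = (\<Sum>i=1..n. ucoef p i * design_sum i)"
  have pos: "0 \<le> ucoef p i * design_sum i" if "1 \<le> i" for i
    using p that design_sum_nonneg by (simp add: poly_in_A4_iff)
  have le: "poly p (gamma600 j) \<le> g (gamma600 j)" if "j \<in> {1..8}" for j
  proof -
    have "ereal (poly p (gamma600 j)) \<le> h (gamma600 j)"
      using p gamma600_range[OF that] by (simp add: poly_in_A4_iff)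
    then show ?thesis using g[OF that] by simp
  qed
  have E: "ucoef p 12 * 120 \<le> E"
    unfolding E_def design_sum_values(2)[symmetric] using pos
    by (intro member_le_sum) (auto simp: n_def)
  have c12: "0 \<le> ucoef p 12" using p by (simp add: poly_in_A4_iff)
  have LP: "LP_value 120 p = 120 * (node_sum (poly p) - E)"
    using quadrature[of p n] unfolding LP_value_eq E_def by (simp add: n_def)
  have s: "node_sum (poly p) \<le> node_sum g"
    unfolding node_sum_def using le mult600_pos by (intro sum_mono mult_left_mono) (auto intro: less_imp_le)
  show "LP_value 120 p \<le> 120 * node_sum g" using LP s E c12 by simp
  assume eq: "LP_value 120 p = 120 * node_sum g"
  then show "ucoef p 12 = 0" using LP s E c12 by simp
  have "node_sum (poly p) = node_sum g" using eq LP s E c12 by simp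
  then have "(\<Sum>j\<in>{1..8}. mult600 j * (g (gamma600 j) - poly p (gamma600 j))) = 0"
    by (simp add: node_sum_def right_diff_distrib sum_subtractf)
  moreover have "0 \<le> mult600 j * (g (gamma600 j) - poly p (gamma600 j))" if "j \<in> {1..8}" for j
    using le[OF that] mult600_pos[OF that] by simp
  ultimately have *: "\<forall>j\<in>{1..8}. mult600 j * (g (gamma600 j) - poly p (gamma600 j)) = 0"
    by (subst (asm) sum_nonneg_eq_0_iff) auto
  then show "poly p (gamma600 j) = g (gamma600 j)" if "j \<in> {1..8}"
  proof -
    have "mult600 j * (g (gamma600 j) - poly p (gamma600 j)) = 0" using * that by blast
    then show ?thesis using mult600_pos[OF that] by simp
  qed
qed

lemma LP_value_eq_node_sum:
  assumes "degree p \<le> 17" "ucoef p 12 = 0" "\<And>j. j \<in> {1..8} \<Longrightarrow> poly p (gamma600 j) = g (gamma600 j)"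
  shows "LP_value 120 p = 120 * node_sum g"
proof -
  have "node_sum (poly p) = node_sum g" unfolding node_sum_def using assms(3) by simp
  moreover have "(\<Sum>i=1..17. ucoef p i * design_sum i) = 0"
    using assms(2) design_sum_values(3) by (intro sum.neutral) force
  ultimately show ?thesis using quadrature[OF assms(1)] by (simp add: LP_value_eq)
qed

theorem theorem5p3:
  fixes h :: "real \<Rightarrow> ereal" and f :: "real poly"
  assumes "absolutely_monotone h" and "degree f \<le> 17"
  shows "LP_optimal 120 h f \<longleftrightarrow>
    (\<exists>a b c :: real. 0 \<le> a \<and> 0 \<le> b \<and> 0 \<le> c \<and> a + b + c = 1 \<and>
       f = smult a (f_Lambda1 h) + smult b (f_Lambda2 h) + smult c (f_Lambda3 h))"
proof -
  obtain g r d where "newton_expansion g r d" and hg: "\<And>t. t \<in> {-1..<1} \<Longrightarrow> h t = ereal (g t)"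
    and g_def: "g = (\<lambda>t. real_of_ereal (h t))"
    using absolutely_monotone_newton[OF assms(1)] by blast
  interpret newton_expansion g r d by fact
  have hgj: "h (gamma600 j) = ereal (g (gamma600 j))" if "j \<in> {1..8}" for j
    using hg gamma600_range[OF that] .
  have interp: "interpolates J h p \<longleftrightarrow> (\<forall>j\<in>{1..8}. poly p (gamma600 j) = g (gamma600 j)) \<and>
      (\<forall>j\<in>J. poly (pderiv p) (gamma600 j) = poly (pderiv H) (gamma600 j))" if "J \<subseteq> {1..8}" for J p
    unfolding interpolates_def g_def[symmetric]
    by (intro conj_cong ball_cong refl) (use that in \<open>auto simp: hgj deriv_g_iff subset_iff\<close>)
  have set18: "{1..8::nat} = insert 1 {2..8}" by auto
  note w = poly_pderiv_Wpoly_minus_1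
  have interp3: "interpolates {2..8} h (H + Wpoly * quad a b c)" for a b c
    using interp[of "{2..8}"] corner_interpolates by auto
  have interp12: "interpolates {1..8} h (H + Wpoly * quad a b c)" if "a - 2 * b + 4 * c = 0" for a b c
  proof -
    have "poly (pderiv (H + Wpoly * quad a b c)) (gamma600 j) = poly (pderiv H) (gamma600 j)" if "j \<in> {1..8}" for j
    proof (cases "j = 1")
      case True
      then show ?thesis
        using corner_interpolates(3)[of a b c] \<open>a - 2 * b + 4 * c = 0\<close> by (simp only: gamma600_eq(1))
    next
      case False
      then show ?thesis using that by (intro corner_interpolates(2)) auto
    qed
    then show ?thesis using interp[of "{1..8}"] corner_interpolates(1) by blast
  qed
  have form3: "\<exists>a b c. p = H + Wpoly * quad a b c" if "interpolates {2..8} h p" "degree p \<le> 17" for p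
    using interp[of "{2..8}" p] that eq_H_plus_Wpoly_quad[of p] by (metis atLeastatMost_subset_iff one_le_numeral order_refl)
  \<comment> \<open>Matching the derivative at -1 means that the quadratic vanishes there, since the
    derivative of \<open>Wpoly\<close> at -1 is nonzero.\<close>
  have form12: "\<exists>a b c. p = H + Wpoly * quad a b c \<and> a - 2 * b + 4 * c = 0"
    if int: "interpolates {1..8} h p" and deg: "degree p \<le> 17" for p
  proof -
    have "interpolates {2..8} h p" using int by (auto simp: interpolates_def)
    then obtain a b c where p: "p = H + Wpoly * quad a b c" using form3 deg by blast
    have "poly (pderiv p) (- 1) = poly (pderiv H) (- 1)"
      using interp[of "{1..8}" p] int unfolding set18 by (simp add: gamma600_eq(1)[simplified])
    then show ?thesis using p corner_interpolates(3)[of a b c] w by auto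
  qed
  have L1: "p \<in> Lambda1 \<longleftrightarrow> degree p \<le> 17 \<and> ucoef p 11 = 0 \<and> ucoef p 12 = 0" for p
  proof -
    have "{i. 10 < i \<and> i < 13} = {11, 12::nat}" by auto
    then show ?thesis unfolding Lambda1_def poly_space_iff[of 10 13 17, simplified] by (auto simp: set_eq_iff)
  qed
  have L2: "p \<in> Lambda2 \<longleftrightarrow> degree p \<le> 17 \<and> ucoef p 12 = 0 \<and> ucoef p 13 = 0" for p
  proof -
    have "{i. 11 < i \<and> i < 14} = {12, 13::nat}" by auto
    then show ?thesis unfolding Lambda2_def poly_space_iff[of 11 14 17, simplified] by (auto simp: set_eq_iff)
  qed
  have L3: "p \<in> Lambda3 \<longleftrightarrow> degree p \<le> 17 \<and> ucoef p 11 = 0 \<and> ucoef p 12 = 0 \<and> ucoef p 13 = 0" for p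
  proof -
    have "{i. 10 < i \<and> i < 14} = {11, 12, 13::nat}" by auto
    then show ?thesis unfolding Lambda3_def poly_space_iff[of 10 14 17, simplified] by (auto simp: set_eq_iff)
  qed
  have A4: "poly (H + Wpoly * quad a b c) \<in> A4 h"
    if "\<And>i. 0 \<le> ucoef (H + Wpoly * quad a b c) i" "0 \<le> c" "a - 2 * b + 4 * c \<le> 0" "a + 2 * b + 4 * c \<le> 0" for a b c
    unfolding poly_in_A4_iff
  proof
    show "\<forall>t\<in>{-1..1}. ereal (poly (H + Wpoly * quad a b c) t) \<le> h t"
      using H_plus_le_g[OF that(2-4)] hg by (intro poly_le_absolutely_monotone[OF assms(1)]) simp
  qed (use that(1) in blast)
  obtain a1 b1 c1 where q1: "\<And>i. 0 \<le> ucoef (H + Wpoly * quad a1 b1 c1) i"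
      "\<And>i. i \<in> set [11, 12] \<Longrightarrow> ucoef (H + Wpoly * quad a1 b1 c1) i = 0"
      "0 \<le> c1" "a1 - 2 * b1 + 4 * c1 \<le> 0" "a1 + 2 * b1 + 4 * c1 \<le> 0" "a1 - 2 * b1 + 4 * c1 = 0"
    using corner_exists[OF corner_check_1] by metis
  obtain a2 b2 c2 where q2: "\<And>i. 0 \<le> ucoef (H + Wpoly * quad a2 b2 c2) i"
      "\<And>i. i \<in> set [12, 13] \<Longrightarrow> ucoef (H + Wpoly * quad a2 b2 c2) i = 0"
      "0 \<le> c2" "a2 - 2 * b2 + 4 * c2 \<le> 0" "a2 + 2 * b2 + 4 * c2 \<le> 0" "a2 - 2 * b2 + 4 * c2 = 0"
    using corner_exists[OF corner_check_2] by metis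
  obtain a3 b3 c3 where q3: "\<And>i. 0 \<le> ucoef (H + Wpoly * quad a3 b3 c3) i"
      "\<And>i. i \<in> set [11, 12, 13] \<Longrightarrow> ucoef (H + Wpoly * quad a3 b3 c3) i = 0"
      "0 \<le> c3" "a3 - 2 * b3 + 4 * c3 \<le> 0" "a3 + 2 * b3 + 4 * c3 \<le> 0"
    using corner_exists[OF corner_check_3] by metis
  define f1 f2 f3 where "f1 = H + Wpoly * quad a1 b1 c1" and "f2 = H + Wpoly * quad a2 b2 c2"
    and "f3 = H + Wpoly * quad a3 b3 c3"
  note f_def = f1_def f2_def f3_def
  have u1: "ucoef f1 11 = 0" "ucoef f1 12 = 0" and u2: "ucoef f2 12 = 0" "ucoef f2 13 = 0"
    and u3: "ucoef f3 11 = 0" "ucoef f3 12 = 0" "ucoef f3 13 = 0"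
    using q1(2) q2(2) q3(2) by (simp_all add: f_def del: ucoef_add)
  have F1: "f_Lambda1 h = f1"
    unfolding f_Lambda1_def
  proof (rule the_equality)
    show "f1 \<in> Lambda1 \<and> interpolates {1..8} h f1"
      using u1 interp12[OF q1(6)] degree_H_plus by (simp add: L1 f1_def)
    fix p assume p: "p \<in> Lambda1 \<and> interpolates {1..8} h p"
    then obtain a b c where e: "p = H + Wpoly * quad a b c" "a - 2 * b + 4 * c = 0"
      using form12[of p] by (auto simp: L1)
    have "ucoef p 11 = 0" "ucoef p 12 = 0" using p by (auto simp: L1)
    then have "a = a1" "b = b1" "c = c1"
      using e(2) q1(6) u1 unfolding e(1) f1_def ucoef_corner by linarith+
    then show "p = f1" using e(1) f1_def by simp
  qed
  have F2: "f_Lambda2 h = f2"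
    unfolding f_Lambda2_def
  proof (rule the_equality)
    show "f2 \<in> Lambda2 \<and> interpolates {1..8} h f2"
      using u2 interp12[OF q2(6)] degree_H_plus by (simp add: L2 f2_def)
    fix p assume p: "p \<in> Lambda2 \<and> interpolates {1..8} h p"
    then obtain a b c where e: "p = H + Wpoly * quad a b c" "a - 2 * b + 4 * c = 0"
      using form12[of p] by (auto simp: L2)
    have "ucoef p 12 = 0" "ucoef p 13 = 0" using p by (auto simp: L2)
    then have "a = a2" "b = b2" "c = c2"
      using e(2) q2(6) u2 unfolding e(1) f2_def ucoef_corner by linarith+
    then show "p = f2" using e(1) f2_def by simp
  qed
  have F3: "f_Lambda3 h = f3"
    unfolding f_Lambda3_def
  proof (rule the_equality)
    show "f3 \<in> Lambda3 \<and> interpolates {2..8} h f3"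
      using u3 interp3 degree_H_plus by (simp add: L3 f3_def)
    fix p assume p: "p \<in> Lambda3 \<and> interpolates {2..8} h p"
    then obtain a b c where e: "p = H + Wpoly * quad a b c"
      using form3[of p] by (auto simp: L3)
    have "ucoef p 11 = 0" "ucoef p 12 = 0" "ucoef p 13 = 0" using p by (auto simp: L3)
    then have "a = a3" "b = b3" "c = c3"
      using u3 unfolding e f3_def ucoef_corner by linarith+
    then show "p = f3" using e f3_def by simp
  qed
  have A: "poly f1 \<in> A4 h" "poly f2 \<in> A4 h" "poly f3 \<in> A4 h"
    unfolding f_def using A4 q1 q2 q3 by blast+
  have touch: "poly f1 (gamma600 j) = g (gamma600 j)" "poly f2 (gamma600 j) = g (gamma600 j)"
    "poly f3 (gamma600 j) = g (gamma600 j)" if "j \<in> {1..8}" for j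
    unfolding f_def using corner_interpolates(1)[OF that] by blast+
  have deg: "degree f1 \<le> 17" "degree f2 \<le> 17" "degree f3 \<le> 17"
    unfolding f_def by (rule degree_H_plus)+
  let ?M = "120 * node_sum g"
  have sup: "(SUP p\<in>{p. poly p \<in> A4 h}. ereal (LP_value 120 p)) = ereal ?M"
  proof (rule antisym)
    show "(SUP p\<in>{p. poly p \<in> A4 h}. ereal (LP_value 120 p)) \<le> ereal ?M"
      using LP_value_le(1) hgj by (intro SUP_least) auto
    \<comment> \<open>The supremum equals the bound because a corner attains it.\<close>
    have "LP_value 120 f1 = ?M"
      using LP_value_eq_node_sum[OF deg(1) u1(2)] touch(1) by blast
    then show "ereal ?M \<le> (SUP p\<in>{p. poly p \<in> A4 h}. ereal (LP_value 120 p))"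
      using A(1) by (intro SUP_upper2[of f1]) auto
  qed
  have opt: "LP_optimal 120 h f \<longleftrightarrow> poly f \<in> A4 h \<and> LP_value 120 f = ?M"
    unfolding LP_optimal_def sup by simp
  show ?thesis
    unfolding F1 F2 F3
  proof
    assume "LP_optimal 120 h f"
    then have fA: "poly f \<in> A4 h" and fM: "LP_value 120 f = ?M" using opt by auto
    have u12: "ucoef f 12 = 0" and t: "\<And>j. j \<in> {1..8} \<Longrightarrow> poly f (gamma600 j) = g (gamma600 j)"
      using LP_value_le(2,3)[OF fA hgj fM] by auto
    have le: "poly f t \<le> g t" if "t \<in> {-1..<1}" for t
      using fA that hg[OF that] by (auto simp: poly_in_A4_iff dest!: bspec[of _ _ t])
    have der: "((\<lambda>t. g t - poly f t) has_real_derivative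
        poly (pderiv H) (gamma600 j) - poly (pderiv f) (gamma600 j)) (at (gamma600 j) within {-1..<1})"
      if "j \<in> {1..8}" for j
      by (intro DERIV_diff deriv_g that DERIV_subset[OF poly_DERIV]) auto
    \<comment> \<open>The nonnegative function g - f vanishes at the node, an interior minimum, so
      its derivative is zero there.\<close>
    have d0: "poly (pderiv f) (gamma600 j) = poly (pderiv H) (gamma600 j)" if j: "j \<in> {2..8}" for j
    proof -
      let ?x = "gamma600 j"
      have j': "j \<in> {1..8}" using j by auto
      have x: "?x \<in> {-1<..<1}" using gamma600_interior[OF j] .
      have "at ?x within {-1..<1} = at ?x"
        using x by (intro at_within_interior) (simp add: interior_atLeastLessThan)
      then have "((\<lambda>t. g t - poly f t) has_real_derivative
          poly (pderiv H) ?x - poly (pderiv f) ?x) (at ?x)" using der[OF j'] by simp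
      moreover have "\<forall>y. \<bar>?x - y\<bar> < min (?x + 1) (1 - ?x) \<longrightarrow> g ?x - poly f ?x \<le> g y - poly f y"
        using le t[OF j'] by (auto simp: abs_if split: if_splits)
      ultimately have "poly (pderiv H) ?x - poly (pderiv f) ?x = 0"
        using x by (intro DERIV_local_min[where d = "min (?x + 1) (1 - ?x)"]) auto
      then show ?thesis by simp
    qed
    obtain a b c where e: "f = H + Wpoly * quad a b c"
      using eq_H_plus_Wpoly_quad[OF assms(2) t d0] by blast
    \<comment> \<open>At the endpoint the minimum only bounds the one-sided derivative: were it
      negative, g - f would be negative just to the right of -1.\<close>
    have "0 \<le> poly (pderiv H) (- 1) - poly (pderiv f) (- 1)"
    proof (rule ccontr)
      assume neg: "\<not> ?thesis"
      have "((\<lambda>t. g t - poly f t) has_real_derivative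
          poly (pderiv H) (- 1) - poly (pderiv f) (- 1)) (at (- 1) within {-1..<1})"
        using der[of 1] by (simp add: gamma600_eq(1)[simplified])
      from has_real_derivative_neg_dec_right[OF this] neg obtain \<epsilon> where \<epsilon>: "0 < \<epsilon>"
        "\<And>s. 0 < s \<Longrightarrow> -1 + s \<in> {-1..<1} \<Longrightarrow> s < \<epsilon> \<Longrightarrow> g (-1 + s) - poly f (-1 + s) < g (-1) - poly f (-1)"
        by auto
      define s where "s = min (\<epsilon> / 2) 1"
      have s: "0 < s" "-1 + s \<in> {-1..<1}" "s < \<epsilon>" using \<epsilon>(1) by (auto simp: s_def)
      have "g (-1) - poly f (-1) = 0" using t[of 1] by (simp add: gamma600_eq(1)[simplified])
      then show False using \<epsilon>(2)[OF s] le[OF s(2)] by simp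
    qed
    then have "a - 2 * b + 4 * c \<le> 0"
      using w unfolding e corner_interpolates(3) by (simp add: mult_le_0_iff)
    moreover have "0 \<le> ucoef f 11" "0 \<le> ucoef f 13" using fA by (auto simp: poly_in_A4_iff)
    ultimately show "\<exists>a b c. 0 \<le> a \<and> 0 \<le> b \<and> 0 \<le> c \<and> a + b + c = 1 \<and>
        f = smult a f1 + smult b f2 + smult c f3"
      using triangle_convex[OF e u12 _ _ _ f1_def u1 q1(6) f2_def u2 q2(6) f3_def u3] by blast
  next
    assume "\<exists>a b c. 0 \<le> a \<and> 0 \<le> b \<and> 0 \<le> c \<and> a + b + c = 1 \<and>
        f = smult a f1 + smult b f2 + smult c f3"
    then obtain a b c where abc: "0 \<le> a" "0 \<le> b" "0 \<le> c" "a + b + c = 1"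
      and e: "f = smult a f1 + smult b f2 + smult c f3" by blast
    \<comment> \<open>Weights of sum one preserve the common node values of the corners and their
      common bound \<open>g\<close>.\<close>
    have comb: "a * x + b * x + c * x = x" for x
      using abc(4) by (metis distrib_right mult_1)
    have "poly f t \<le> g t" if t: "t \<in> {-1..<1}" for t
    proof -
      have "poly f1 t \<le> g t" "poly f2 t \<le> g t" "poly f3 t \<le> g t"
        using A t hg[OF t] by (auto simp: poly_in_A4_iff dest!: bspec[of _ _ t])
      then have "a * poly f1 t + b * poly f2 t + c * poly f3 t \<le> a * g t + b * g t + c * g t"
        using abc by (intro add_mono mult_left_mono)
      then show ?thesis by (simp add: e comb)
    qed
    then have "\<forall>t\<in>{-1..1}. ereal (poly f t) \<le> h t"
      using hg by (intro poly_le_absolutely_monotone[OF assms(1)]) auto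
    moreover have "0 \<le> ucoef f i" if "1 \<le> i" for i
      using A abc that by (simp add: e poly_in_A4_iff)
    ultimately have "poly f \<in> A4 h" by (simp add: poly_in_A4_iff)
    moreover have "LP_value 120 f = ?M"
      using touch u1 u2 u3 by (intro LP_value_eq_node_sum[OF assms(2)]) (simp_all add: e comb)
    ultimately show "LP_optimal 120 h f" using opt by simp
  qed
qed

end
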